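(* Let $k$ be a field of characteristic $p>0$, let $P$ be a finite poset, $D=J(P)$, $R=\mathcal{R}_k[D]$ the Hibi ring, and $\mathfrak{m}=R_+$ its graded maximal ideal. Then the diagonal $F$-threshold $c^{\mathfrak{m}}(\mathfrak{m})$ exists and \[ c^{\mathfrak{m}}(\mathfrak{m})=\operatorname{rank}^{*}P+2 . \]
   Context: Let $P=\{p_1,\dots,p_N\}$ be a finite poset and $J(P)$ the set of poset ideals of $P$ (subsets $I\subseteq P$ such that $x\in I$, $y\in P$, $y\le x$ imply $y\in I$; including $\emptyset$ and $P$). The Hibi ring is $\mathcal{R}_k[D]=k[\,T\prod_{p_i\in I}X_i \mid I\in J(P)\,]\subseteq k[T,X_1,\dots,X_N]$, graded so that each generator $T\prod_{p_i\in I}X_i$ has degree $1$; $\mathfrak{m}=R_+$ is the ideal generated by these generators. For $q=p^e$, $\mathfrak{m}^{[q]}=(x^q\mid x\in\mathfrak{m})$, $\nu(p^e)=\max\{r\in\mathbb{N}\mid \mathfrak{m}^r\not\subseteq\mathfrak{m}^{[p^e]}\}$, and $c^{\mathfrak{m}}(\mathfrak{m})=\lim_{e\to\infty}\nu(p^e)/p^e$. Poset notions: $x\lessdot y$ ($y$ covers $x$) means $x<y$ and there is no $z$ with $x<z<y$. A path of $P$ is a sequence $C=(q_1,\dots,q_t)$ of distinct elements of $P$ such that $q_1$ is a minimal element of $P$, for each $i$ either $q_i\lessdot q_{i+1}$ or $q_{i+1}\lessdot q_i$, and $q_{t-1}\lessdot q_t$ (when $t\ge 2$). It is maximal if $q_t$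 is a maximal element of $P$. For $1<i<t$, $q_i$ is locally maximal if $q_{i-1}\lessdot q_i$ and $q_{i+1}\lessdot q_i$, and locally minimal if $q_i\lessdot q_{i-1}$ and $q_i\lessdot q_{i+1}$; by convention $q_1$ is locally minimal and $q_t$ is locally maximal. The decomposition $C=A_1+D_1+A_2+\cdots+D_{n-1}+A_n$ splits the sequence $C$ into consecutive blocks: $A_1$ consists of $q_1$ up to and including the first locally maximal element, $D_1$ of the following elements up to and including the next locally minimal element, $A_2$ of the following elements up to and including the next locally maximal element, and so on, with $A_n$ ending at $q_t$. Each $A_i$ is an ascending chain whose last element $t(A_i)$ is locally maximal, and each $D_i$ is a descending chain; $V(\cdot)$ denotes the set of elements of a block. For an ascending block $A$, $\langle A\rangle=\{q\in P\mid q\le t(A)\}$, and $\langle A_i\setminus t(A_i)\rangle$ is the poset ideal of $P$ generated by the elements of $A_i$ other than $t(A_i)$. The path $C$ satisfies condition ( * ) if for all $1\le i\le n-1$: (1) $V(D_i)\cap\bigl(\bigcup_{m=1}^{i-1}\langle A_m\rangle\cup\langle A_i\setminus t(A_i)\rangle\cup\{t(A_i)\}\bigr)=\emptyset$, and (2) $V(A_{i+1})\cap\bigcup_{m=1}^{i}\langle A_m\rangle=\emptyset$. The upper length is $\operatorname{len}^*C=\#\{i\mid q_i\lessdot q_{i+1}\}$. The upper rank is $\operatorname{rank}^*P=\max\{\operatorname{len}^*C\mid C$ a maximal path satisfying ( * )$\}$. *)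

theory Defs
  imports Complex_Main "HOL-Library.Poly_Mapping" "HOL-Computational_Algebra.Primes"
begin

definition covers :: "'a::order set \<Rightarrow> 'a \<Rightarrow> 'a \<Rightarrow> bool" where
  "covers P x y \<longleftrightarrow> x \<in> P \<and> y \<in> P \<and> x < y \<and> \<not> (\<exists>z\<in>P. x < z \<and> z < y)"

definition minimal_in :: "'a::order set \<Rightarrow> 'a \<Rightarrow> bool" where
  "minimal_in P x \<longleftrightarrow> x \<in> P \<and> \<not> (\<exists>y\<in>P. y < x)"

definition maximal_in :: "'a::order set \<Rightarrow> 'a \<Rightarrow> bool" where
  "maximal_in P x \<longleftrightarrow> x \<in> P \<and> \<not> (\<exists>y\<in>P. x < y)"

definition poset_ideals :: "'a::order set \<Rightarrow> 'a set set" where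
  "poset_ideals P = {I. I \<subseteq> P \<and> (\<forall>x\<in>I. \<forall>y\<in>P. y \<le> x \<longrightarrow> y \<in> I)}"

text \<open>Paths are lists C = [q_1,...,q_t] (indexed from 0 here).\<close>

definition is_path :: "'a::order set \<Rightarrow> 'a list \<Rightarrow> bool" where
  "is_path P C \<longleftrightarrow> C \<noteq> [] \<and> distinct C \<and> set C \<subseteq> P \<and> minimal_in P (C ! 0) \<and>
     (\<forall>i. Suc i < length C \<longrightarrow> covers P (C ! i) (C ! Suc i) \<or> covers P (C ! Suc i) (C ! i)) \<and>
     (length C \<ge> 2 \<longrightarrow> covers P (C ! (length C - 2)) (C ! (length C - 1)))"

definition is_maximal_path :: "'a::order set \<Rightarrow> 'a list \<Rightarrow> bool" where
  "is_maximal_path P C \<longleftrightarrow> is_path P C \<and> maximal_in P (last C)"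

definition loc_max :: "'a::order set \<Rightarrow> 'a list \<Rightarrow> nat \<Rightarrow> bool" where
  "loc_max P C i \<longleftrightarrow> i = length C - 1 \<or>
     (0 < i \<and> i + 1 < length C \<and> covers P (C ! (i - 1)) (C ! i) \<and> covers P (C ! (i + 1)) (C ! i))"

definition loc_min :: "'a::order set \<Rightarrow> 'a list \<Rightarrow> nat \<Rightarrow> bool" where
  "loc_min P C i \<longleftrightarrow> i = 0 \<or>
     (0 < i \<and> i + 1 < length C \<and> covers P (C ! i) (C ! (i - 1)) \<and> covers P (C ! i) (C ! (i + 1)))"

text \<open>Indices (in increasing order) of the locally maximal / locally minimal elements.
  Along a path these alternate, starting with the locally minimal index 0 and ending
  with the locally maximal index t-1; so the i-th ascending block A_i (0-based) runs from
  index 0 (i = 0) resp. from just after the i-th locally minimal index (i > 0) up to and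
  including the i-th locally maximal index, and the i-th descending block D_i runs from
  just after the i-th locally maximal index up to and including the (i+1)-th locally
  minimal index.\<close>

definition tops :: "'a::order set \<Rightarrow> 'a list \<Rightarrow> nat list" where
  "tops P C = filter (loc_max P C) [0..<length C]"

definition bots :: "'a::order set \<Rightarrow> 'a list \<Rightarrow> nat list" where
  "bots P C = filter (loc_min P C) [0..<length C]"

definition nblocks :: "'a::order set \<Rightarrow> 'a list \<Rightarrow> nat" where
  "nblocks P C = length (tops P C)"

definition A_start :: "'a::order set \<Rightarrow> 'a list \<Rightarrow> nat \<Rightarrow> nat" where
  "A_start P C i = (if i = 0 then 0 else bots P C ! i + 1)"

definition V_A :: "'a::order set \<Rightarrow> 'a list \<Rightarrow> nat \<Rightarrow> 'a set" where
  "V_A P C i = (\<lambda>j. C ! j) ` {A_start P C i .. tops P C ! i}"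

definition top_A :: "'a::order set \<Rightarrow> 'a list \<Rightarrow> nat \<Rightarrow> 'a" where
  "top_A P C i = C ! (tops P C ! i)"

definition V_D :: "'a::order set \<Rightarrow> 'a list \<Rightarrow> nat \<Rightarrow> 'a set" where
  "V_D P C i = (\<lambda>j. C ! j) ` {tops P C ! i + 1 .. bots P C ! (i + 1)}"

definition gen_A :: "'a::order set \<Rightarrow> 'a list \<Rightarrow> nat \<Rightarrow> 'a set" where
  "gen_A P C i = {q \<in> P. q \<le> top_A P C i}"

definition gen_A_minus_top :: "'a::order set \<Rightarrow> 'a list \<Rightarrow> nat \<Rightarrow> 'a set" where
  "gen_A_minus_top P C i = {q \<in> P. \<exists>a \<in> V_A P C i - {top_A P C i}. q \<le> a}"

definition cond_star :: "'a::order set \<Rightarrow> 'a list \<Rightarrow> bool" where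
  "cond_star P C \<longleftrightarrow> (\<forall>i. i + 1 < nblocks P C \<longrightarrow>
      V_D P C i \<inter> ((\<Union>m<i. gen_A P C m) \<union> gen_A_minus_top P C i \<union> {top_A P C i}) = {} \<and>
      V_A P C (i + 1) \<inter> (\<Union>m\<le>i. gen_A P C m) = {})"

definition upper_len :: "'a::order set \<Rightarrow> 'a list \<Rightarrow> nat" where
  "upper_len P C = card {i. Suc i < length C \<and> covers P (C ! i) (C ! Suc i)}"

definition upper_rank :: "'a::order set \<Rightarrow> nat" where
  "upper_rank P = Max {upper_len P C | C. is_maximal_path P C \<and> cond_star P C}"

section \<open>Hibi ring inside k[T, X_p : p \<in> P]; variable None is T, Some p is X_p\<close>

type_synonym ('a, 'k) mpoly = "('a option \<Rightarrow>\<^sub>0 nat) \<Rightarrow>\<^sub>0 'k"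

definition hibi_gen :: "'a set \<Rightarrow> ('a, 'k::comm_ring_1) mpoly" where
  "hibi_gen I = Poly_Mapping.single
     (Poly_Mapping.single None 1 + (\<Sum>x\<in>I. Poly_Mapping.single (Some x) 1)) 1"

definition hibi_gens :: "'a::order set \<Rightarrow> ('a, 'k::comm_ring_1) mpoly set" where
  "hibi_gens P = hibi_gen ` poset_ideals P"

inductive_set k_alg :: "('a, 'k::comm_ring_1) mpoly set \<Rightarrow> ('a, 'k) mpoly set"
  for G where
  const: "Poly_Mapping.single 0 c \<in> k_alg G"
| gen: "g \<in> G \<Longrightarrow> g \<in> k_alg G"
| add: "x \<in> k_alg G \<Longrightarrow> y \<in> k_alg G \<Longrightarrow> x + y \<in> k_alg G"
| mult: "x \<in> k_alg G \<Longrightarrow> y \<in> k_alg G \<Longrightarrow> x * y \<in> k_alg G"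

definition hibi_ring :: "'a::order set \<Rightarrow> ('a, 'k::comm_ring_1) mpoly set" where
  "hibi_ring P = k_alg (hibi_gens P)"

definition ideal_gen :: "'r::comm_ring_1 set \<Rightarrow> 'r set \<Rightarrow> 'r set" where
  "ideal_gen R S = {\<Sum>i<n. r i * s i | (n::nat) r s. \<forall>i<n. r i \<in> R \<and> s i \<in> S}"

definition ideal_power :: "'r::comm_ring_1 set \<Rightarrow> 'r set \<Rightarrow> nat \<Rightarrow> 'r set" where
  "ideal_power R M k = ideal_gen R {\<Prod>i<k. x i | x. \<forall>i<k. x i \<in> M}"

definition frobenius_power :: "'r::comm_ring_1 set \<Rightarrow> 'r set \<Rightarrow> nat \<Rightarrow> 'r set" where
  "frobenius_power R M q = ideal_gen R {x ^ q | x. x \<in> M}"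

definition hibi_max_ideal :: "'a::order set \<Rightarrow> ('a, 'k::comm_ring_1) mpoly set" where
  "hibi_max_ideal P = ideal_gen (hibi_ring P) (hibi_gens P)"

definition nu :: "'r::comm_ring_1 set \<Rightarrow> 'r set \<Rightarrow> nat \<Rightarrow> nat" where
  "nu R M q = (GREATEST r. \<not> ideal_power R M r \<subseteq> frobenius_power R M q)"

end

theory Submission
  imports Defs
begin

text \<open>
  Monomials of the Hibi ring correspond to functions \<open>v\<close> on \<open>P\<close> with an added bottom that reverse
  the order; the value at the bottom (the exponent of \<open>T\<close>) is the degree. In characteristic \<open>p\<close>, the
  monomial of \<open>v\<close> lies in the \<open>q\<close>-th Frobenius power iff some poset ideal \<open>I\<close> has
  \<open>v x - v y \<ge> q\<close> on all covers \<open>x \<lessdot> y\<close> leaving \<open>I\<close> (bottom and top of \<open>P\<close> included, where \<open>v\<close> is \<open>0\<close> at the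
  top). Closing up from the bottom, this fails iff a walk of covers leads from bottom to top
  whose upward steps drop \<open>v\<close> by at most \<open>q - 1\<close>; downward steps are free. Such a walk bounds the degree
  by \<open>q - 1\<close> times its number of upward steps. A walk with the fewest upward steps never returns below
  an earlier element after going up, which is condition \<open>(*)\<close>; conversely, along a path satisfying
  \<open>(*)\<close> the bound is attained. Hence \<open>\<nu>(q) = (rank\<^sup>* P + 2) (q - 1)\<close> exactly.
\<close>

section \<open>Monomials of the Hibi ring\<close>

definition hibi_exp :: "'a set \<Rightarrow> 'a option \<Rightarrow>\<^sub>0 nat" where
  "hibi_exp I = Poly_Mapping.single None 1 + (\<Sum>x\<in>I. Poly_Mapping.single (Some x) 1)"

text \<open>The closed form of the set of exponent vectors of Hibi ring monomials:
  \<open>None\<close> acts as a bottom element below \<open>P\<close>, and membership is tested by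
  inequalities instead of by a factorization into generators.\<close>

definition hibi_monoid :: "'a::order set \<Rightarrow> ('a option \<Rightarrow>\<^sub>0 nat) set" where
  "hibi_monoid P = {v. (\<forall>x. x \<notin> P \<longrightarrow> Poly_Mapping.lookup v (Some x) = 0) \<and>
     (\<forall>x\<in>P. Poly_Mapping.lookup v (Some x) \<le> Poly_Mapping.lookup v None) \<and>
     (\<forall>x\<in>P. \<forall>y\<in>P. x \<le> y \<longrightarrow> Poly_Mapping.lookup v (Some y) \<le> Poly_Mapping.lookup v (Some x))}"

lemma lookup_hibi_exp_None [simp]: "Poly_Mapping.lookup (hibi_exp I) None = 1"
  by (simp add: hibi_exp_def lookup_add lookup_sum lookup_single)

lemma lookup_hibi_exp_Some:
  "finite I \<Longrightarrow> Poly_Mapping.lookup (hibi_exp I) (Some x) = (if x \<in> I then 1 else 0)"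
  by (simp add: hibi_exp_def lookup_add lookup_sum lookup_single when_def)

lemma hibi_gen_eq: "hibi_gen I = Poly_Mapping.single (hibi_exp I) 1"
  by (simp add: hibi_gen_def hibi_exp_def)

lemma poset_ideals_subset: "I \<in> poset_ideals P \<Longrightarrow> I \<subseteq> P"
  by (simp add: poset_ideals_def)

lemma poset_ideals_down: "I \<in> poset_ideals P \<Longrightarrow> x \<in> I \<Longrightarrow> y \<in> P \<Longrightarrow> y \<le> x \<Longrightarrow> y \<in> I"
  by (auto simp: poset_ideals_def)

lemma hibi_monoid_0: "0 \<in> hibi_monoid P"
  by (simp add: hibi_monoid_def)

lemma hibi_monoid_add: "u \<in> hibi_monoid P \<Longrightarrow> v \<in> hibi_monoid P \<Longrightarrow> u + v \<in> hibi_monoid P"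
  by (auto simp: hibi_monoid_def lookup_add intro!: add_mono)

lemma hibi_exp_in_hibi_monoid:
  assumes "finite P" "I \<in> poset_ideals P"
  shows "hibi_exp I \<in> hibi_monoid P"
  using assms poset_ideals_subset[OF assms(2)] poset_ideals_down[OF assms(2)]
  by (auto simp: hibi_monoid_def lookup_hibi_exp_Some finite_subset)

text \<open>Cutting an exponent vector at the heights \<open>0, 1, \<dots>\<close> yields the poset ideals.\<close>

lemma hibi_monoid_decompose:
  assumes "finite P" "v \<in> hibi_monoid P"
  obtains J where "\<And>i. J i \<in> poset_ideals P"
    and "v = (\<Sum>i<Poly_Mapping.lookup v None. hibi_exp (J i))"
proof
  define J where "J i = {x\<in>P. i < Poly_Mapping.lookup v (Some x)}" for i
  have "y \<in> J i" if "x \<in> J i" "y \<in> P" "y \<le> x" for i x y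
    using that assms(2) unfolding J_def hibi_monoid_def by fastforce
  then show "J i \<in> poset_ideals P" for i
    by (auto simp: poset_ideals_def J_def)
  have fin: "finite (J i)" for i
    using assms(1) by (simp add: J_def)
  let ?N = "Poly_Mapping.lookup v None"
  show "v = (\<Sum>i<?N. hibi_exp (J i))"
  proof (rule poly_mapping_eqI)
    fix k
    show "Poly_Mapping.lookup v k = Poly_Mapping.lookup (\<Sum>i<?N. hibi_exp (J i)) k"
    proof (cases k)
      case None
      then show ?thesis by (simp add: lookup_sum)
    next
      case (Some x)
      have "{i. i < ?N \<and> x \<in> J i} = {..<Poly_Mapping.lookup v (Some x)}"
        using assms(2) by (cases "x \<in> P") (fastforce simp: J_def hibi_monoid_def)+
      moreover have "Poly_Mapping.lookup (\<Sum>i<?N. hibi_exp (J i)) (Some x)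
          = card {i. i < ?N \<and> x \<in> J i}"
        by (simp add: lookup_sum lookup_hibi_exp_Some fin sum.If_cases Int_def)
      ultimately show ?thesis using Some by simp
    qed
  qed
qed

section \<open>Supports, powers and characteristic of polynomials\<close>

lemma keys_sum_subset: "Poly_Mapping.keys (\<Sum>i\<in>A. f i) \<subseteq> (\<Union>i\<in>A. Poly_Mapping.keys (f i))"
proof (induction A rule: infinite_finite_induct)
  case (insert x A)
  then show ?case using keys_add[of "f x" "sum f A"] by auto
qed auto

lemma sum_single_keys: "(\<Sum>k\<in>Poly_Mapping.keys f. Poly_Mapping.single k (Poly_Mapping.lookup f k)) = f"
proof (rule poly_mapping_eqI)
  fix k
  have "Poly_Mapping.lookup (\<Sum>k\<in>Poly_Mapping.keys f. Poly_Mapping.single k (Poly_Mapping.lookup f k)) k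
      = (\<Sum>j\<in>Poly_Mapping.keys f. if k = j then Poly_Mapping.lookup f j else 0)"
    by (auto simp: lookup_sum lookup_single when_def intro!: sum.cong)
  then show "Poly_Mapping.lookup (\<Sum>k\<in>Poly_Mapping.keys f. Poly_Mapping.single k (Poly_Mapping.lookup f k)) k
      = Poly_Mapping.lookup f k"
    by (simp add: in_keys_iff)
qed

lemma prod_single_one:
  "(\<Prod>i\<in>A. Poly_Mapping.single (f i) (1::'k::comm_ring_1))
     = Poly_Mapping.single (\<Sum>i\<in>A. f i :: 'b::comm_monoid_add) 1"
  by (induction A rule: infinite_finite_induct) (auto simp: mult_single)

text \<open>The exponents form only an additive monoid here, so the multiple of \<open>v\<close> by
  \<open>n\<close> is written as a sum of \<open>n\<close> copies.\<close>

lemma single_one_power: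
  "Poly_Mapping.single (v::'b::comm_monoid_add) (1::'k::comm_ring_1) ^ n
     = Poly_Mapping.single (\<Sum>i<n. v) 1"
  by (induction n) (auto simp: mult_single add_ac)

lemma lookup_sum_const: "Poly_Mapping.lookup (\<Sum>i<n. v :: 'b \<Rightarrow>\<^sub>0 nat) x = n * Poly_Mapping.lookup v x"
  by (simp add: lookup_sum)

text \<open>Natural numbers embed as constants, whose coefficient at exponent 0 detects whether they
  vanish. This transfers the characteristic of \<open>'k\<close> to polynomials, so that the
  Frobenius identity applies to them.\<close>

lemma CHAR_poly_mapping:
  "CHAR('b::comm_monoid_add \<Rightarrow>\<^sub>0 'k::comm_semiring_1) = CHAR('k)"
proof (rule CHAR_eqI)
  have *: "(of_nat n :: 'b \<Rightarrow>\<^sub>0 'k) = Poly_Mapping.single 0 (of_nat n)" for n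
    by simp
  show "(of_nat CHAR('k) :: 'b \<Rightarrow>\<^sub>0 'k) = 0"
    unfolding * by simp
  fix n
  assume "(of_nat n :: 'b \<Rightarrow>\<^sub>0 'k) = 0"
  then have "Poly_Mapping.lookup (of_nat n :: 'b \<Rightarrow>\<^sub>0 'k) 0 = 0"
    by (simp only: lookup_zero)
  then have "(of_nat n :: 'k) = 0"
    by (simp add: lookup_of_nat)
  then show "CHAR('k) dvd n"
    by (simp add: of_nat_eq_0_iff_char_dvd)
qed

section \<open>Ideals generated by a set\<close>

lemma ideal_genI:
  assumes "r \<in> R" "s \<in> S" shows "r * s \<in> ideal_gen R S"
  unfolding ideal_gen_def using assms
  by (intro CollectI exI[of _ "Suc 0"] exI[of _ "\<lambda>_. r"] exI[of _ "\<lambda>_. s"]) simp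

lemma ideal_gen_0: "0 \<in> ideal_gen R S"
  unfolding ideal_gen_def by (intro CollectI exI[of _ "0"]) simp

lemma ideal_gen_add:
  assumes "a \<in> ideal_gen R S" "b \<in> ideal_gen R S"
  shows "a + b \<in> ideal_gen R S"
proof -
  from assms obtain m r s n r' s' where
    a: "a = (\<Sum>i<(m::nat). r i * s i)" "\<forall>i<m. r i \<in> R \<and> s i \<in> S" and
    b: "b = (\<Sum>i<(n::nat). r' i * s' i)" "\<forall>i<n. r' i \<in> R \<and> s' i \<in> S"
    unfolding ideal_gen_def by blast
  \<comment> \<open>The two linear combinations are concatenated into one of length
    \<open>m + n\<close>.\<close>
  define r2 where "r2 i = (if i < m then r i else r' (i - m))" for i
  define s2 where "s2 i = (if i < m then s i else s' (i - m))" for i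
  have split: "{..<m + n} = {..<m} \<union> {m..<m + n}" by auto
  have "(\<Sum>i<m + n. r2 i * s2 i) = (\<Sum>i<m. r2 i * s2 i) + (\<Sum>i\<in>{m..<m + n}. r2 i * s2 i)"
    unfolding split by (rule sum.union_disjoint) auto
  also have "(\<Sum>i<m. r2 i * s2 i) = a"
    by (simp add: a r2_def s2_def)
  also have "(\<Sum>i\<in>{m..<m + n}. r2 i * s2 i) = b"
    using sum.shift_bounds_nat_ivl[of "\<lambda>i. r2 i * s2 i" 0 m n]
    by (simp add: b r2_def s2_def atLeast0LessThan add.commute)
  finally have "a + b = (\<Sum>i<m + n. r2 i * s2 i)" by simp
  moreover have "\<forall>i<m + n. r2 i \<in> R \<and> s2 i \<in> S"
    using a(2) b(2) by (auto simp: r2_def s2_def)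
  ultimately show ?thesis unfolding ideal_gen_def by blast
qed

lemma ideal_gen_sum:
  "finite A \<Longrightarrow> (\<And>i. i \<in> A \<Longrightarrow> f i \<in> ideal_gen R S) \<Longrightarrow> (\<Sum>i\<in>A. f i) \<in> ideal_gen R S"
  by (induction A rule: finite_induct) (auto intro: ideal_gen_0 ideal_gen_add)

lemma keys_mult_subset:
  assumes "Poly_Mapping.keys f \<subseteq> A" "Poly_Mapping.keys g \<subseteq> B"
    "\<And>a b. a \<in> A \<Longrightarrow> b \<in> B \<Longrightarrow> a + b \<in> C"
  shows "Poly_Mapping.keys (f * g) \<subseteq> C"
  using keys_mult[of f g] assms by blast

text \<open>Reduces a bound on supports in an ideal to products of one coefficient and one
  generator, as supports of sums lie in the union of the supports.\<close>

lemma keys_ideal_gen: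
  assumes "f \<in> ideal_gen R S" "\<And>r s. r \<in> R \<Longrightarrow> s \<in> S \<Longrightarrow> Poly_Mapping.keys (r * s) \<subseteq> A"
  shows "Poly_Mapping.keys f \<subseteq> A"
proof -
  from assms(1) obtain n r s where
    f: "f = (\<Sum>i<(n::nat). r i * s i)" "\<forall>i<n. r i \<in> R \<and> s i \<in> S"
    unfolding ideal_gen_def by blast
  have "Poly_Mapping.keys f \<subseteq> (\<Union>i<n. Poly_Mapping.keys (r i * s i))"
    unfolding f(1) by (rule keys_sum_subset)
  also have "\<dots> \<subseteq> A" using f(2) assms(2) by blast
  finally show ?thesis .
qed

section \<open>Supports in the Hibi ring, its maximal ideal and the ordinary powers\<close>

lemma keys_hibi_ring:
  assumes "finite P" "f \<in> (hibi_ring P :: ('a::order, 'k::comm_ring_1) mpoly set)"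
  shows "Poly_Mapping.keys f \<subseteq> hibi_monoid P"
  using assms(2) unfolding hibi_ring_def
proof (induction rule: k_alg.induct)
  case (const c)
  then show ?case by (simp add: hibi_monoid_0)
next
  case (gen g)
  then show ?case
    using assms(1) by (auto simp: hibi_gens_def hibi_gen_eq intro: hibi_exp_in_hibi_monoid)
next
  case (add x y)
  then show ?case using keys_add[of x y] by blast
next
  case (mult x y)
  then show ?case by (intro keys_mult_subset[OF mult.IH]) (auto intro: hibi_monoid_add)
qed

lemma k_alg_prod:
  assumes "\<And>i. i \<in> A \<Longrightarrow> f i \<in> k_alg G"
  shows "(\<Prod>i\<in>A. f i) \<in> k_alg G"
  using assms
proof (induction A rule: infinite_finite_induct)
  case (insert x A)
  then show ?case by (auto intro: k_alg.mult)
qed (use k_alg.const[of 1 G] in auto)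

text \<open>The decomposition into level sets writes the monomial as a product of generators. With
  \<open>keys_hibi_ring\<close> this makes the Hibi ring the span of the monomials with exponent in
  \<open>hibi_monoid P\<close>.\<close>

lemma single_in_hibi_ring:
  assumes "finite P" "v \<in> hibi_monoid P"
  shows "Poly_Mapping.single v c \<in> (hibi_ring P :: ('a::order, 'k::comm_ring_1) mpoly set)"
proof -
  obtain J where J: "\<And>i. J i \<in> poset_ideals P"
    "v = (\<Sum>i<Poly_Mapping.lookup v None. hibi_exp (J i))"
    using hibi_monoid_decompose[OF assms] by blast
  have "(\<Prod>i<Poly_Mapping.lookup v None. hibi_gen (J i)) \<in> (hibi_ring P :: ('a, 'k) mpoly set)"
    unfolding hibi_ring_def using J(1) by (intro k_alg_prod k_alg.gen) (simp add: hibi_gens_def)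
  moreover have "(\<Prod>i<Poly_Mapping.lookup v None. hibi_gen (J i)) = Poly_Mapping.single v (1::'k)"
    by (subst (2) J(2)) (simp add: hibi_gen_eq prod_single_one)
  ultimately have "Poly_Mapping.single 0 c * Poly_Mapping.single v 1 \<in> (hibi_ring P :: ('a, 'k) mpoly set)"
    unfolding hibi_ring_def by (metis k_alg.const k_alg.mult)
  then show ?thesis by (simp add: mult_single)
qed

lemma hibi_gen_in_max_ideal:
  assumes "I \<in> poset_ideals P"
  shows "hibi_gen I \<in> (hibi_max_ideal P :: ('a::order, 'k::comm_ring_1) mpoly set)"
proof -
  have "(1 :: ('a, 'k) mpoly) \<in> hibi_ring P"
    unfolding hibi_ring_def using k_alg.const[of 1] by simp
  from ideal_genI[OF this, of "hibi_gen I" "hibi_gens P"] assms show ?thesis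
    by (simp add: hibi_max_ideal_def hibi_gens_def)
qed

lemma keys_hibi_max_ideal:
  assumes "finite P" "f \<in> (hibi_max_ideal P :: ('a::order, 'k::comm_ring_1) mpoly set)"
  shows "Poly_Mapping.keys f \<subseteq> {v \<in> hibi_monoid P. 1 \<le> Poly_Mapping.lookup v None}"
  using assms(2) unfolding hibi_max_ideal_def
proof (rule keys_ideal_gen)
  fix r s :: "('a, 'k) mpoly"
  assume r: "r \<in> hibi_ring P" and s: "s \<in> hibi_gens P"
  then have "Poly_Mapping.keys s \<subseteq> {v \<in> hibi_monoid P. 1 \<le> Poly_Mapping.lookup v None}"
    using assms(1) by (auto simp: hibi_gens_def hibi_gen_eq intro: hibi_exp_in_hibi_monoid)
  then show "Poly_Mapping.keys (r * s) \<subseteq> {v \<in> hibi_monoid P. 1 \<le> Poly_Mapping.lookup v None}"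
    by (rule keys_mult_subset[OF keys_hibi_ring[OF assms(1) r]])
      (auto intro: hibi_monoid_add simp: lookup_add)
qed

text \<open>The exponent of \<open>None\<close> is the degree; it is additive and at least 1 on each
  of the \<open>n\<close> factors.\<close>

lemma keys_ideal_power_hibi_max_ideal:
  assumes "finite P"
    "f \<in> ideal_power (hibi_ring P) (hibi_max_ideal P :: ('a::order, 'k::comm_ring_1) mpoly set) n"
  shows "Poly_Mapping.keys f \<subseteq> {v \<in> hibi_monoid P. n \<le> Poly_Mapping.lookup v None}"
  using assms(2) unfolding ideal_power_def
proof (rule keys_ideal_gen)
  let ?S = "\<lambda>n. {v \<in> hibi_monoid P. n \<le> Poly_Mapping.lookup v None}"
  have prod: "Poly_Mapping.keys (\<Prod>i<n. x i :: ('a, 'k) mpoly) \<subseteq> ?S n" if "\<forall>i<n. x i \<in> hibi_max_ideal P" for x n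
    using that
  proof (induction n)
    case 0
    then show ?case by (simp add: hibi_monoid_0)
  next
    case (Suc n)
    have IH: "Poly_Mapping.keys (\<Prod>i<n. x i) \<subseteq> ?S n"
      using Suc by simp
    have "Poly_Mapping.keys (x n) \<subseteq> ?S 1"
      using keys_hibi_max_ideal[OF assms(1)] Suc.prems by blast
    from keys_mult_subset[OF IH this, of "?S (Suc n)"] show ?case
      by (auto intro: hibi_monoid_add simp: lookup_add)
  qed
  fix r s :: "('a, 'k) mpoly"
  assume r: "r \<in> hibi_ring P" and s: "s \<in> {\<Prod>i<n. x i | x. \<forall>i<n. x i \<in> hibi_max_ideal P}"
  then have "Poly_Mapping.keys s \<subseteq> ?S n"
    using prod by blast
  then show "Poly_Mapping.keys (r * s) \<subseteq> ?S n"
    by (rule keys_mult_subset[OF keys_hibi_ring[OF assms(1) r]])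
      (auto intro: hibi_monoid_add simp: lookup_add)
qed

section \<open>Monomials of the Frobenius power\<close>

definition frobenius_exps :: "'a::order set \<Rightarrow> nat \<Rightarrow> ('a option \<Rightarrow>\<^sub>0 nat) set" where
  "frobenius_exps P q = {u + (\<Sum>i<q. hibi_exp I) | u I. u \<in> hibi_monoid P \<and> I \<in> poset_ideals P}"

lemma frobenius_exps_add:
  "u \<in> hibi_monoid P \<Longrightarrow> v \<in> frobenius_exps P q \<Longrightarrow> u + v \<in> frobenius_exps P q"
proof -
  assume "u \<in> hibi_monoid P" "v \<in> frobenius_exps P q"
  then obtain w I where "v = w + (\<Sum>i<q. hibi_exp I)" "w \<in> hibi_monoid P" "I \<in> poset_ideals P"
    by (auto simp: frobenius_exps_def)
  moreover from this have "u + v = (u + w) + (\<Sum>i<q. hibi_exp I)" by (simp add: add.assoc)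
  ultimately show ?thesis
    unfolding frobenius_exps_def using \<open>u \<in> hibi_monoid P\<close> hibi_monoid_add by blast
qed

text \<open>A monomial with exponent in \<open>frobenius_exps P q\<close> is a ring element times
  the \<open>q\<close>-th power of a generator, and the polynomial is the sum of its terms.\<close>

lemma in_frobenius_powerI:
  fixes f :: "('a::order, 'k::comm_ring_1) mpoly"
  assumes "finite P" "Poly_Mapping.keys f \<subseteq> frobenius_exps P q"
  shows "f \<in> frobenius_power (hibi_ring P) (hibi_max_ideal P) q"
proof -
  have "Poly_Mapping.single v c \<in> frobenius_power (hibi_ring P) (hibi_max_ideal P) q"
    if v: "v \<in> frobenius_exps P q" for v and c :: 'k
  proof -
    obtain u I where *: "v = u + (\<Sum>i<q. hibi_exp I)" "u \<in> hibi_monoid P" "I \<in> poset_ideals P"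
      using v by (auto simp: frobenius_exps_def)
    have "Poly_Mapping.single v c = Poly_Mapping.single u c * hibi_gen I ^ q"
      by (simp add: * hibi_gen_eq single_one_power mult_single)
    then show ?thesis
      using single_in_hibi_ring[OF assms(1) *(2), of c] hibi_gen_in_max_ideal[OF *(3), where 'k = 'k]
      unfolding frobenius_power_def by (auto intro!: ideal_genI)
  qed
  then have "(\<Sum>v\<in>Poly_Mapping.keys f. Poly_Mapping.single v (Poly_Mapping.lookup f v))
      \<in> frobenius_power (hibi_ring P) (hibi_max_ideal P) q"
    unfolding frobenius_power_def using assms(2) by (intro ideal_gen_sum) auto
  then show ?thesis
    by (simp add: sum_single_keys)
qed

text \<open>The place where the characteristic enters: for \<open>q = p ^ e\<close> the
  \<open>q\<close>-th power of a combination of generators is the sum of the \<open>q\<close>-th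
  powers of its terms, each a multiple of the \<open>q\<close>-th power of one generator.\<close>

lemma keys_frobenius_power:
  fixes f :: "('a::order, 'k::comm_ring_1) mpoly"
  assumes "finite P" "prime p" "CHAR('k) = p"
    and "f \<in> frobenius_power (hibi_ring P) (hibi_max_ideal P) (p ^ e)"
  shows "Poly_Mapping.keys f \<subseteq> frobenius_exps P (p ^ e)"
  using assms(4) unfolding frobenius_power_def
proof (rule keys_ideal_gen)
  let ?q = "p ^ e"
  fix r s :: "('a, 'k) mpoly"
  assume r: "r \<in> hibi_ring P" and "s \<in> {x ^ ?q |x. x \<in> hibi_max_ideal P}"
  then obtain x where x: "s = x ^ ?q" "x \<in> hibi_max_ideal P" by blast
  then obtain n a g where
    ag: "x = (\<Sum>i<(n::nat). a i * g i)" "\<forall>i<n. a i \<in> hibi_ring P \<and> g i \<in> hibi_gens P"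
    unfolding hibi_max_ideal_def ideal_gen_def by blast
  have "CHAR(('a, 'k) mpoly) = p"
    using assms(3) by (simp add: CHAR_poly_mapping)
  then have "s = (\<Sum>i<n. (a i * g i) ^ ?q)"
    unfolding x(1) ag(1) using assms(2) by (intro freshmans_dream_sum') auto
  then have "Poly_Mapping.keys s \<subseteq> (\<Union>i<n. Poly_Mapping.keys ((a i * g i) ^ ?q))"
    using keys_sum_subset by metis
  also have "\<dots> \<subseteq> frobenius_exps P ?q"
  proof (rule UN_least)
    fix i assume "i \<in> {..<n}"
    with ag(2) obtain I where ai: "a i \<in> hibi_ring P" and I: "I \<in> poset_ideals P" "g i = hibi_gen I"
      by (auto simp: hibi_gens_def)
    have "a i ^ m \<in> hibi_ring P" for m
      using ai k_alg_prod[of "{..<m}" "\<lambda>_. a i" "hibi_gens P"] by (simp add: hibi_ring_def)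
    from keys_hibi_ring[OF assms(1) this]
    have "Poly_Mapping.keys (a i ^ ?q) \<subseteq> hibi_monoid P" .
    moreover have "Poly_Mapping.keys (g i ^ ?q) \<subseteq> {\<Sum>i<?q. hibi_exp I}"
      by (simp add: I(2) hibi_gen_eq single_one_power)
    ultimately show "Poly_Mapping.keys ((a i * g i) ^ ?q) \<subseteq> frobenius_exps P ?q"
      unfolding power_mult_distrib
      by (rule keys_mult_subset) (use I(1) in \<open>auto simp: frobenius_exps_def\<close>)
  qed
  finally show "Poly_Mapping.keys (r * s) \<subseteq> frobenius_exps P ?q"
    by (rule keys_mult_subset[OF keys_hibi_ring[OF assms(1) r]]) (rule frobenius_exps_add)
qed

text \<open>Computing \<open>nu\<close> becomes maximizing the degree over exponents outside
  \<open>frobenius_exps\<close>: the monomial of \<open>v\<close> witnesses non-containment in its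
  degree, and any element witnessing it for \<open>n\<close> has a term of degree at least
  \<open>n\<close> with such an exponent.\<close>

lemma nu_hibi_eqI:
  fixes P :: "'a::order set"
  assumes "finite P" "prime p" "CHAR('k::comm_ring_1) = p"
    and "v \<in> hibi_monoid P" "v \<notin> frobenius_exps P (p ^ e)"
    and max: "\<And>u. u \<in> hibi_monoid P \<Longrightarrow> u \<notin> frobenius_exps P (p ^ e) \<Longrightarrow>
            Poly_Mapping.lookup u None \<le> Poly_Mapping.lookup v None"
  shows "nu (hibi_ring P :: ('a, 'k) mpoly set) (hibi_max_ideal P) (p ^ e) = Poly_Mapping.lookup v None"
  unfolding nu_def
proof (rule Greatest_equality)
  let ?N = "Poly_Mapping.lookup v None" and ?M = "hibi_max_ideal P :: ('a, 'k) mpoly set"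
  obtain J where J: "\<And>i. J i \<in> poset_ideals P" "v = (\<Sum>i<?N. hibi_exp (J i))"
    using hibi_monoid_decompose[OF assms(1,4)] by blast
  have "(1 :: ('a, 'k) mpoly) \<in> hibi_ring P"
    using single_in_hibi_ring[OF assms(1) hibi_monoid_0, of "1::'k"] by simp
  moreover have "(\<Prod>i<?N. hibi_gen (J i)) = Poly_Mapping.single v (1::'k)"
    by (subst (2) J(2)) (simp add: hibi_gen_eq prod_single_one)
  moreover have "\<forall>i<?N. hibi_gen (J i) \<in> ?M"
    using hibi_gen_in_max_ideal[OF J(1)] by blast
  ultimately have "1 * Poly_Mapping.single v 1 \<in> ideal_power (hibi_ring P) ?M ?N"
    unfolding ideal_power_def
    by (intro ideal_genI CollectI exI[of _ "\<lambda>i. hibi_gen (J i)"]) auto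
  moreover have "Poly_Mapping.single v 1 \<notin> frobenius_power (hibi_ring P) ?M (p ^ e)"
  proof
    assume "Poly_Mapping.single v 1 \<in> frobenius_power (hibi_ring P) ?M (p ^ e)"
    from keys_frobenius_power[OF assms(1-3) this] show False
      using assms(5) by simp
  qed
  ultimately show "\<not> ideal_power (hibi_ring P) ?M ?N \<subseteq> frobenius_power (hibi_ring P) ?M (p ^ e)"
    by auto
next
  let ?N = "Poly_Mapping.lookup v None" and ?M = "hibi_max_ideal P :: ('a, 'k) mpoly set"
  fix n
  assume "\<not> ideal_power (hibi_ring P) ?M n \<subseteq> frobenius_power (hibi_ring P) ?M (p ^ e)"
  then obtain f where f: "f \<in> ideal_power (hibi_ring P) ?M n" "f \<notin> frobenius_power (hibi_ring P) ?M (p ^ e)"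
    by blast
  from f(2) obtain u where u: "u \<in> Poly_Mapping.keys f" "u \<notin> frobenius_exps P (p ^ e)"
    using in_frobenius_powerI[OF assms(1)] by blast
  then have "u \<in> hibi_monoid P" "n \<le> Poly_Mapping.lookup u None"
    using keys_ideal_power_hibi_max_ideal[OF assms(1) f(1)] by auto
  with max[OF _ u(2)] show "n \<le> ?N"
    by simp
qed

section \<open>Paths in finite posets\<close>

lemma covers_less: "covers P x y \<Longrightarrow> x < y"
  by (simp add: covers_def)

lemma covers_asym: "covers P x y \<Longrightarrow> \<not> covers P y x"
  by (auto simp: covers_def)

section \<open>Upper length of walks and existence of chains\<close>

lemma upper_len_Cons:
  "upper_len P (x # y # l) = (if covers P x y then 1 else 0) + upper_len P (y # l)"
proof -
  let ?S = "\<lambda>C. {i. Suc i < length C \<and> covers P (C ! i) (C ! Suc i)}"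
  have "finite (?S (y # l))" by (rule finite_subset[of _ "{..<length (y # l)}"]) auto
  moreover have "?S (x # y # l) = (if covers P x y then {0} else {}) \<union> Suc ` ?S (y # l)"
  proof (rule set_eqI)
    fix i show "i \<in> ?S (x # y # l) \<longleftrightarrow> i \<in> (if covers P x y then {0} else {}) \<union> Suc ` ?S (y # l)"
      by (cases i) (auto simp: image_iff)
  qed
  ultimately show ?thesis
    unfolding upper_len_def by (auto simp: card_image card_insert_if)
qed

lemma upper_len_singleton [simp]: "upper_len P [x] = 0"
  by (simp add: upper_len_def)

text \<open>The cut element \<open>a\<close> is kept in both parts, so every step is counted exactly
  once.\<close>

lemma upper_len_append: "upper_len P (xs @ a # ys) = upper_len P (xs @ [a]) + upper_len P (a # ys)"
proof (induction xs)
  case (Cons x xs)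
  then show ?case by (cases xs) (auto simp: upper_len_Cons)
qed simp

lemma upper_len_descending: "successively (\<lambda>x y. covers P y x) C \<Longrightarrow> upper_len P C = 0"
proof (induction C rule: induct_list012)
  case (3 x y zs)
  then show ?case using covers_asym by (auto simp: upper_len_Cons)
qed (auto simp: upper_len_def)

lemma upper_len_eq_0_iff:
  "upper_len P C = 0 \<longleftrightarrow> (\<forall>i. Suc i < length C \<longrightarrow> \<not> covers P (C ! i) (C ! Suc i))"
proof -
  have "finite {i. Suc i < length C \<and> covers P (C ! i) (C ! Suc i)}"
    by (rule finite_subset[of _ "{..<length C}"]) auto
  then show ?thesis by (auto simp: upper_len_def)
qed

text \<open>Without upward steps every step descends. The strict inequality excludes closed walks of
  upper length 0.\<close>

lemma upper_len_0_last_less: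
  assumes "successively (\<lambda>x y. covers P x y \<or> covers P y x) (a # l)" "l \<noteq> []" "upper_len P (a # l) = 0"
  shows "last l < a"
  using assms
proof (induction l arbitrary: a)
  case (Cons b l)
  have "b < a" and 0: "upper_len P (b # l) = 0"
    using Cons.prems by (auto simp: upper_len_Cons covers_less split: if_splits)
  then show ?case using Cons.IH[of b] Cons.prems by (cases "l = []") auto
qed simp

lemma descending_chain:
  assumes "finite P" "a \<in> P" "b \<in> P" "b \<le> a"
  obtains ds where "ds \<noteq> []" "hd ds = a" "last ds = b" "successively (\<lambda>x y. covers P y x) ds"
proof -
  have "\<exists>ds. ds \<noteq> [] \<and> hd ds = a \<and> last ds = b \<and> successively (\<lambda>x y. covers P y x) ds"
    using assms(2,4)
  proof (induction "card {z\<in>P. b \<le> z \<and> z < a}" arbitrary: a rule: less_induct)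
    case (less a)
    show ?case
    proof (cases "a = b")
      case True
      then show ?thesis by (intro exI[of _ "[a]"]) simp
    next
      case False
      let ?Z = "{z\<in>P. b \<le> z \<and> z < a}"
      have fin: "finite ?Z" using assms(1) by simp
      have "b \<in> ?Z" using False less.prems assms(3) by auto
      \<comment> \<open>An element maximal among those above \<open>b\<close> and strictly below
        \<open>a\<close> is covered by \<open>a\<close>; the chain continues from it.\<close>
      then obtain c where c: "c \<in> ?Z" "\<forall>z\<in>?Z. c \<le> z \<longrightarrow> c = z"
        using finite_has_maximal[OF fin] by blast
      have cov: "covers P c a"
        using c less.prems unfolding covers_def by (auto dest: less_imp_le order_trans)
      have "{z\<in>P. b \<le> z \<and> z < c} \<subset> ?Z" using c(1) by auto
      then have "card {z\<in>P. b \<le> z \<and> z < c} < card ?Z" using fin by (rule psubset_card_mono[rotated])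
      then obtain ds where "ds \<noteq> []" "hd ds = c" "last ds = b" "successively (\<lambda>x y. covers P y x) ds"
        using less.hyps[of c] c(1) by auto
      then show ?thesis using cov by (intro exI[of _ "a # ds"]) (auto simp: successively_Cons)
    qed
  qed
  then show ?thesis using that by blast
qed

lemma ex_minimal_below:
  assumes "finite P" "x \<in> P" obtains m where "minimal_in P m" "m \<le> x"
proof -
  have "finite {y\<in>P. y \<le> x}" "{y\<in>P. y \<le> x} \<noteq> {}" using assms by auto
  from finite_has_minimal[OF this] obtain m where
    m: "m \<in> P" "m \<le> x" "\<forall>y\<in>P. y \<le> x \<longrightarrow> y \<le> m \<longrightarrow> m = y" by blast
  then have "minimal_in P m"
    unfolding minimal_in_def by (metis order.strict_implies_order order.trans order_less_irrefl)
  then show ?thesis using m that by blast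
qed

lemma ex_maximal_above:
  assumes "finite P" "x \<in> P" obtains m where "maximal_in P m" "x \<le> m"
proof -
  have "finite {y\<in>P. x \<le> y}" "{y\<in>P. x \<le> y} \<noteq> {}" using assms by auto
  from finite_has_maximal[OF this] obtain m where
    m: "m \<in> P" "x \<le> m" "\<forall>y\<in>P. x \<le> y \<longrightarrow> m \<le> y \<longrightarrow> m = y" by blast
  then have "maximal_in P m"
    unfolding maximal_in_def by (metis order.strict_implies_order order.trans order_less_irrefl)
  then show ?thesis using m that by blast
qed

text \<open>An index-free form of condition \<open>(*)\<close>: a path never returns below an earlier element
  after an upward step.\<close>

definition no_return :: "'a::order set \<Rightarrow> 'a list \<Rightarrow> bool" where
  "no_return P C \<longleftrightarrow> (\<forall>i j k. i \<le> k \<longrightarrow> k < j \<longrightarrow> j < length C \<longrightarrow> C ! j \<le> C ! i \<longrightarrow>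
      \<not> covers P (C ! k) (C ! Suc k))"

lemma split_list_two:
  assumes "i < j" "j < length C"
  obtains xs ys zs where "C = xs @ C ! i # ys @ C ! j # zs" "length xs = i" "length ys = j - Suc i"
proof -
  have "C = take i C @ C ! i # drop (Suc i) C"
    using assms by (simp add: id_take_nth_drop)
  moreover have "drop (Suc i) C = take (j - Suc i) (drop (Suc i) C) @ drop (Suc i) C ! (j - Suc i) # drop (Suc (j - Suc i)) (drop (Suc i) C)"
    using assms by (intro id_take_nth_drop) auto
  moreover have "drop (Suc i) C ! (j - Suc i) = C ! j" using assms by simp
  ultimately show ?thesis
    using assms by (intro that[of "take i C" "take (j - Suc i) (drop (Suc i) C)" "drop (Suc j) C"]) auto
qed

text \<open>Among all walks with the given ends one of least upper length is chosen. A stretch from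
  \<open>a\<close> to some \<open>b\<close> below it can be replaced by a descending chain, which
  \<open>step\<close> always permits and which costs no upward step.\<close>

lemma ex_no_return_walk:
  assumes "finite P"
    and step: "\<And>x y. step x y \<Longrightarrow> covers P x y \<or> covers P y x" "\<And>x y. covers P y x \<Longrightarrow> step x y"
    and C: "C \<noteq> []" "set C \<subseteq> P" "successively step C"
  obtains C' where "C' \<noteq> []" "set C' \<subseteq> P" "successively step C'" "hd C' = hd C" "last C' = last C"
    "distinct C'" "no_return P C'"
proof -
  define W where "W B \<longleftrightarrow> B \<noteq> [] \<and> set B \<subseteq> P \<and> successively step B \<and> hd B = hd C \<and> last B = last C" for B
  have "W C" using C by (simp add: W_def)
  then obtain B where B: "W B" and least: "\<And>A. W A \<Longrightarrow> upper_len P B \<le> upper_len P A"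
    using ex_has_least_nat[of W C "upper_len P"] by blast
  \<comment> \<open>By minimality, the replaced stretch had no upward step either.\<close>
  have key: "upper_len P (a # ys @ [b]) = 0" if eq: "B = xs @ a # ys @ b # zs" and "b \<le> a" for xs a ys b zs
  proof -
    have "a \<in> P" "b \<in> P" using B eq by (auto simp: W_def)
    then obtain ds where ds: "ds \<noteq> []" "hd ds = a" "last ds = b" "successively (\<lambda>x y. covers P y x) ds"
      using descending_chain[OF assms(1)] \<open>b \<le> a\<close> by metis
    have "successively step ds"
      using ds(4) by (rule successively_mono) (use step(2) in blast)
    \<comment> \<open>A one-element chain has no adjacent pair to yield membership in
      \<open>P\<close>, hence the case distinction.\<close>
    moreover have "set ds \<subseteq> P"
    proof (cases "tl ds = []")
      case True
      then show ?thesis using ds \<open>a \<in> P\<close> by (cases ds) auto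
    next
      case False
      have "set ds \<subseteq> P" if "successively (\<lambda>x y. covers P y x) ds" "length ds \<ge> 2" for ds
        using that
      proof (induction ds rule: induct_list012)
        case (3 x y zs)
        then show ?case by (cases zs) (auto simp: covers_def)
      qed auto
      moreover have "length ds \<ge> 2" using False by (cases ds; cases "tl ds") auto
      ultimately show ?thesis using ds(4) by blast
    qed
    ultimately have "W (xs @ ds @ zs)"
      using B ds unfolding W_def eq
      by (auto simp: successively_append_iff successively_Cons hd_append last_append)
    then have le: "upper_len P B \<le> upper_len P (xs @ ds @ zs)" by (rule least)
    obtain ds1 where ds1: "ds = a # ds1" using ds by (cases ds) auto
    obtain ds2 where ds2: "ds = ds2 @ [b]" using ds(1,3) append_butlast_last_id by metis
    have "upper_len P (xs @ ds @ zs) = upper_len P (xs @ [a]) + upper_len P (ds @ zs)"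
      using upper_len_append[of P xs a "ds1 @ zs"] ds1 by simp
    also have "upper_len P (ds @ zs) = upper_len P ds + upper_len P (b # zs)"
      using upper_len_append[of P ds2 b zs] ds2 by simp
    also have "upper_len P ds = 0" using ds(4) by (rule upper_len_descending)
    finally have "upper_len P (xs @ ds @ zs) = upper_len P (xs @ [a]) + upper_len P (b # zs)" by simp
    moreover have "upper_len P B = upper_len P (xs @ [a]) + (upper_len P (a # ys @ [b]) + upper_len P (b # zs))"
      unfolding eq using upper_len_append[of P xs a "ys @ b # zs"] upper_len_append[of P "a # ys" b zs] by simp
    ultimately show ?thesis using le by simp
  qed
  \<comment> \<open>A repeated element bounds a stretch to which \<open>key\<close> applies; it
    would then descend strictly from \<open>y\<close> to \<open>y\<close>.\<close>
  have "distinct B"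
  proof (rule ccontr)
    assume "\<not> distinct B"
    then obtain xs ys zs y where eq: "B = xs @ [y] @ ys @ [y] @ zs"
      using not_distinct_decomp by blast
    then have "upper_len P (y # ys @ [y]) = 0" using key[of xs y ys y zs] by simp
    moreover have "successively step (xs @ (y # ys @ [y]) @ zs)"
      using B unfolding W_def eq by simp
    then have "successively step (y # ys @ [y])"
      unfolding successively_append_iff by blast
    then have "successively (\<lambda>x y. covers P x y \<or> covers P y x) (y # ys @ [y])"
      by (rule successively_mono) (use step(1) in blast)
    ultimately have "last (ys @ [y]) < y" by (intro upper_len_0_last_less) auto
    then show False by simp
  qed
  moreover have "no_return P B"
    unfolding no_return_def
  proof (intro allI impI)
    fix i j k assume ijk: "i \<le> k" "k < j" "j < length B" "B ! j \<le> B ! i"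
    then have "i < j" by simp
    then obtain xs ys zs where s: "B = xs @ B ! i # ys @ B ! j # zs" "length xs = i" "length ys = j - Suc i"
      using split_list_two ijk(3) by metis
    let ?S = "B ! i # ys @ [B ! j]"
    have nth: "?S ! m = B ! (i + m)" if "i + m \<le> j" for m
    proof -
      have "B ! (i + m) = (xs @ ?S @ zs) ! (i + m)" using s(1) by simp
      also have "\<dots> = ?S ! m" using that s(2,3) \<open>i < j\<close> unfolding nth_append by auto
      finally show ?thesis by simp
    qed
    have "\<not> covers P (?S ! (k - i)) (?S ! Suc (k - i))"
      using key[OF s(1) ijk(4)] s(3) ijk unfolding upper_len_eq_0_iff by simp
    then show "\<not> covers P (B ! k) (B ! Suc k)"
      using nth[of "k - i"] nth[of "Suc (k - i)"] ijk by simp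
  qed
  ultimately show ?thesis using B that unfolding W_def by blast
qed

text \<open>Cutting the range at \<open>j\<close> cuts the filtered list. Comparing the position of
  the \<open>i\<close>-th selected index with \<open>j\<close> thus becomes counting the selected
  indices before \<open>j\<close>.\<close>

lemma filter_upt_nth_less_iff:
  assumes "j \<le> n" "i < length (filter Q [0..<n])"
  shows "filter Q [0..<n] ! i < j \<longleftrightarrow> i < length (filter Q [0..<j])"
proof -
  have "[0..<n] = [0..<j] @ [j..<n]" using assms(1) le_Suc_ex upt_add_eq_append by blast
  then have eq: "filter Q [0..<n] = filter Q [0..<j] @ filter Q [j..<n]" by simp
  show ?thesis
  proof (cases "i < length (filter Q [0..<j])")
    case True
    then have "filter Q [0..<n] ! i \<in> set (filter Q [0..<j])"
      unfolding eq nth_append using nth_mem[OF True] by simp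
    with True show ?thesis by simp
  next
    case False
    then have "filter Q [0..<n] ! i \<in> set (filter Q [j..<n])"
      unfolding eq nth_append using assms(2) eq by (auto simp del: set_filter intro!: nth_mem)
    with False show ?thesis by simp
  qed
qed

text \<open>\<open>B i\<close>, \<open>T i\<close> abbreviate the \<open>i\<close>-th locally minimal and locally maximal indices. All facts
  on their interlacing come from \<open>count\<close>: before index \<open>j\<close>, the locally minimal indices outnumber
  the locally maximal ones by one or zero, according to whether the step into \<open>j\<close> goes up.\<close>

context
  fixes P :: "'a::order set" and C :: "'a list"
  assumes path: "is_path P C"
begin

abbreviation "up k \<equiv> covers P (C ! k) (C ! Suc k)"
abbreviation "n_bots j \<equiv> length (filter (loc_min P C) [0..<j])"
abbreviation "n_tops j \<equiv> length (filter (loc_max P C) [0..<j])"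
abbreviation "B i \<equiv> bots P C ! i"
abbreviation "T i \<equiv> tops P C ! i"

lemma path_len: "length C > 0" and path_distinct: "distinct C" and path_set: "set C \<subseteq> P"
  and path_min: "minimal_in P (C ! 0)"
  and path_step: "Suc i < length C \<Longrightarrow> \<not> up i \<Longrightarrow> covers P (C ! Suc i) (C ! i)"
  and path_last: "2 \<le> length C \<Longrightarrow> covers P (C ! (length C - 2)) (C ! (length C - 1))"
  using path by (auto simp: is_path_def)

lemma path_covers_iff: "Suc i < length C \<Longrightarrow> covers P (C ! Suc i) (C ! i) \<longleftrightarrow> \<not> up i"
  using path_step covers_asym by blast

lemma up_0: "Suc 0 < length C \<Longrightarrow> up 0"
  using path_min path_step[of 0] by (auto simp: minimal_in_def covers_def)

text \<open>The last index is locally maximal by convention and is left out. Likewise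
  \<open>loc_min_iff\<close> leaves out index 0.\<close>

lemma loc_max_iff: "Suc j < length C \<Longrightarrow> loc_max P C j \<longleftrightarrow> 0 < j \<and> up (j - 1) \<and> \<not> up j"
  using path_covers_iff[of j] by (cases j) (auto simp: loc_max_def)

lemma loc_min_iff: "Suc j < length C \<Longrightarrow> 0 < j \<Longrightarrow> loc_min P C j \<longleftrightarrow> \<not> up (j - 1) \<and> up j"
  using path_covers_iff[of "j - 1"] by (cases j) (auto simp: loc_min_def)

lemma loc_max_last: "loc_max P C (length C - 1)"
  by (simp add: loc_max_def)

lemma count:
  assumes "0 < j" "j < length C"
  shows "n_bots j = n_tops j + (if up (j - 1) then 1 else 0)"
  using assms
proof (induction j)
  case (Suc j)
  show ?case
  proof (cases "j = 0")
    case True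
    \<comment> \<open>Index 0 is locally minimal by convention, and the first step goes up since the
      path starts at a minimal element.\<close>
    then show ?thesis using up_0 Suc.prems loc_max_iff[of 0] by (simp add: loc_min_def)
  next
    case False
    \<comment> \<open>One of the two counts grows exactly when the direction changes at
      \<open>j\<close>.\<close>
    then show ?thesis using Suc loc_max_iff[of j] loc_min_iff[of j] by auto
  qed
qed simp

text \<open>Before the last index the locally minimal ones lead by one, as the last step goes up;
  the last index, locally maximal by convention, restores the balance. In a one-element path index 0
  is of both kinds.\<close>

lemma count_length: "length (bots P C) = length (tops P C)"
proof (cases "length C = 1")
  case True
  then show ?thesis by (simp add: bots_def tops_def loc_min_def loc_max_def)
next
  case False
  then obtain m where m: "length C = Suc (Suc m)" using path_len by (cases "length C"; cases "length C - 1") auto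
  have "up m" using path_last m by simp
  moreover have "loc_max P C (Suc m)" "\<not> loc_min P C (Suc m)"
    using m by (auto simp: loc_max_def loc_min_def)
  moreover have "n_bots (Suc m) = n_tops (Suc m) + 1" using count[of "Suc m"] m \<open>up m\<close> by simp
  moreover have "length (bots P C) = n_bots (Suc m)" "length (tops P C) = n_tops (Suc m) + 1"
    using \<open>loc_max P C (Suc m)\<close> \<open>\<not> loc_min P C (Suc m)\<close> by (simp_all add: bots_def tops_def m)
  ultimately show ?thesis by simp
qed

lemma n_tops_mono: "i \<le> j \<Longrightarrow> n_tops i \<le> n_tops j"
  by (metis filter_append le_add1 le_add_diff_inverse length_append upt_add_eq_append zero_le)

lemma n_bots_mono: "i \<le> j \<Longrightarrow> n_bots i \<le> n_bots j"
  by (metis filter_append le_add1 le_add_diff_inverse length_append upt_add_eq_append zero_le)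

lemma T_less_iff: "j \<le> length C \<Longrightarrow> i < nblocks P C \<Longrightarrow> T i < j \<longleftrightarrow> i < n_tops j"
  unfolding tops_def nblocks_def by (rule filter_upt_nth_less_iff)

lemma B_less_iff: "j \<le> length C \<Longrightarrow> i < nblocks P C \<Longrightarrow> B i < j \<longleftrightarrow> i < n_bots j"
  using count_length unfolding bots_def nblocks_def tops_def by (intro filter_upt_nth_less_iff) auto

lemma T_less_length: "i < nblocks P C \<Longrightarrow> T i < length C"
  using T_less_iff[of "length C" i] by (simp add: nblocks_def tops_def)

lemma B_less_length: "i < nblocks P C \<Longrightarrow> B i < length C"
  using B_less_iff[of "length C" i] count_length by (simp add: nblocks_def tops_def bots_def)

lemma n_tops_less: "j < length C \<Longrightarrow> n_tops j < nblocks P C"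
proof -
  assume j: "j < length C"
  obtain m where m: "length C = Suc m" using path_len by (cases "length C") auto
  have "n_tops j \<le> n_tops m" using j m by (intro n_tops_mono) simp
  moreover have "loc_max P C m" using loc_max_last m by simp
  ultimately show ?thesis by (simp add: nblocks_def tops_def m)
qed

lemma n_tops_T: "i < nblocks P C \<Longrightarrow> n_tops (T i) = i \<and> n_tops (Suc (T i)) = Suc i"
proof -
  assume i: "i < nblocks P C"
  have "T i \<in> set (tops P C)" using i by (simp add: nblocks_def)
  then have "n_tops (Suc (T i)) = Suc (n_tops (T i))" by (simp add: tops_def)
  moreover have "i < n_tops (Suc (T i))" "\<not> i < n_tops (T i)"
    using T_less_iff[of "Suc (T i)" i] T_less_iff[of "T i" i] i T_less_length[OF i] by auto
  ultimately show ?thesis by simp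
qed

lemma n_bots_B: "i < nblocks P C \<Longrightarrow> n_bots (B i) = i \<and> n_bots (Suc (B i)) = Suc i"
proof -
  assume i: "i < nblocks P C"
  have "B i \<in> set (bots P C)" using i count_length by (simp add: nblocks_def)
  then have "n_bots (Suc (B i)) = Suc (n_bots (B i))" by (simp add: bots_def)
  moreover have "i < n_bots (Suc (B i))" "\<not> i < n_bots (B i)"
    using B_less_iff[of "Suc (B i)" i] B_less_iff[of "B i" i] i B_less_length[OF i] by auto
  ultimately show ?thesis by simp
qed

text \<open>A downward step would make both counts equal by \<open>count\<close>, but from
  \<open>B i\<close> to \<open>T i\<close> at least \<open>i + 1\<close> locally minimal and at most
  \<open>i\<close> locally maximal indices have been passed. The descending case below is
  dual.\<close>

lemma up_ascending:
  assumes "i < nblocks P C" "B i \<le> k" "k < T i" shows "up k"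
proof (rule ccontr)
  assume "\<not> up k"
  then have "n_bots (Suc k) = n_tops (Suc k)" using count[of "Suc k"] T_less_length[OF assms(1)] assms(3) by simp
  moreover have "Suc i \<le> n_bots (Suc k)"
    using n_bots_mono[of "Suc (B i)" "Suc k"] n_bots_B[OF assms(1)] assms(2) by simp
  moreover have "n_tops (Suc k) \<le> i"
    using n_tops_mono[of "Suc k" "T i"] n_tops_T[OF assms(1)] assms(3) by simp
  ultimately show False by simp
qed

lemma not_up_descending:
  assumes "Suc i < nblocks P C" "T i \<le> k" "k < B (Suc i)" shows "\<not> up k"
proof
  assume "up k"
  then have "n_bots (Suc k) = Suc (n_tops (Suc k))" using count[of "Suc k"] B_less_length[OF assms(1)] assms(3) by simp
  moreover have "Suc i \<le> n_tops (Suc k)"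
    using n_tops_mono[of "Suc (T i)" "Suc k"] n_tops_T[of i] assms(1,2) by simp
  moreover have "n_bots (Suc k) \<le> Suc i"
    using n_bots_mono[of "Suc k" "B (Suc i)"] n_bots_B[OF assms(1)] assms(3) by simp
  ultimately show False by simp
qed

text \<open>The step into a locally minimal index other than 0 goes down, so \<open>count\<close>
  puts \<open>i + 1\<close> locally maximal indices before \<open>B (Suc i)\<close>.\<close>

lemma T_less_B:
  assumes "Suc i < nblocks P C" shows "T i < B (Suc i)"
proof -
  let ?j = "B (Suc i)"
  have nb: "n_bots ?j = Suc i" and j: "?j < length C"
    using n_bots_B[OF assms] B_less_length[OF assms] by auto
  then have "0 < ?j" by (cases ?j) auto
  have "loc_min P C ?j"
    using assms count_length nth_mem[of "Suc i" "bots P C"] by (simp add: nblocks_def bots_def)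
  with \<open>0 < ?j\<close> have "\<not> up (?j - 1)" using covers_asym by (cases ?j) (auto simp: loc_min_def)
  then have "n_tops ?j = Suc i" using count[OF \<open>0 < ?j\<close> j] nb by simp
  then show ?thesis using T_less_iff[of ?j i] assms j by simp
qed

lemma up_B:
  assumes "Suc i < nblocks P C" shows "up (B (Suc i))"
proof -
  have "loc_min P C (B (Suc i))"
    using assms count_length nth_mem[of "Suc i" "bots P C"] by (simp add: nblocks_def bots_def)
  with T_less_B[OF assms] show ?thesis by (auto simp: loc_min_def)
qed

lemma up_before_T:
  assumes "i < nblocks P C" "k < T i" "T i < length C - 1" shows "up (T i - 1)"
proof -
  have "loc_max P C (T i)"
    using assms(1) nth_mem[of i "tops P C"] by (simp add: nblocks_def tops_def)
  with assms show ?thesis by (cases "T i") (auto simp: loc_max_def)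
qed

lemma T_strict_mono: "i < j \<Longrightarrow> j < nblocks P C \<Longrightarrow> T i < T j"
  using T_less_iff[of "T j" i] n_tops_T[of j] T_less_length[of j] by simp

lemma T_less_A_start:
  assumes "i < j" "j < nblocks P C" shows "T i < A_start P C j"
proof -
  obtain m where m: "j = Suc m" "i \<le> m" using assms(1) by (cases j) auto
  have "T i \<le> T m" using T_strict_mono[of i m] m assms by (cases "i = m") auto
  also have "\<dots> < B j" using T_less_B m assms by simp
  finally show ?thesis using m(1) by (simp add: A_start_def)
qed

text \<open>The direction of the step into \<open>j\<close> decides the kind of block, and the
  number of locally maximal indices before \<open>j\<close> gives its number.\<close>

lemma index_cases:
  assumes "j < length C"
  obtains (asc) i where "i < nblocks P C" "A_start P C i \<le> j" "j \<le> T i"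
        | (desc) i where "Suc i < nblocks P C" "T i < j" "j \<le> B (Suc i)"
proof (cases "j = 0 \<or> up (j - 1)")
  case True
  let ?b = "n_tops j"
  have b: "?b < nblocks P C" by (rule n_tops_less[OF assms])
  have "j \<le> T ?b" using T_less_iff[of j ?b] b assms by simp
  moreover have "A_start P C ?b \<le> j"
  proof (cases "?b = 0")
    case False
    then have "0 < j" by (cases j) auto
    then have "n_bots j = Suc ?b" using count[of j] True assms by simp
    then show ?thesis using B_less_iff[of j ?b] b assms by (simp add: A_start_def)
  qed (simp add: A_start_def)
  ultimately show ?thesis using asc b by blast
next
  case False
  then have "0 < j" by simp
  with False have eq: "n_bots j = n_tops j" using count[of j] assms by simp
  \<comment> \<open>Index 0 is always counted, so the common count is positive and the block number
    is its predecessor.\<close>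
  have "n_bots (Suc 0) \<le> n_bots j" using \<open>0 < j\<close> by (intro n_bots_mono) simp
  moreover have "n_bots (Suc 0) = 1" by (simp add: loc_min_def)
  ultimately obtain b where b: "n_bots j = Suc b" by (cases "n_bots j") auto
  have "Suc b < nblocks P C" using n_tops_less[OF assms] eq b by simp
  then show ?thesis
    using desc[of b] T_less_iff[of j b] B_less_iff[of j "Suc b"] eq b assms by simp
qed

section \<open>Equivalence of \<open>cond_star\<close> and \<open>no_return\<close> on paths\<close>

lemma ascending_run: "i \<le> j \<Longrightarrow> j < length C \<Longrightarrow> (\<And>k. i \<le> k \<Longrightarrow> k < j \<Longrightarrow> up k) \<Longrightarrow> C ! i \<le> C ! j"
proof (induction rule: dec_induct)
  case (step m)
  then have "C ! i \<le> C ! m" "up m" by auto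
  then show ?case using covers_less order.trans less_imp_le by metis
qed simp

lemma descending_run: "i \<le> j \<Longrightarrow> j < length C \<Longrightarrow> (\<And>k. i \<le> k \<Longrightarrow> k < j \<Longrightarrow> \<not> up k) \<Longrightarrow> C ! j \<le> C ! i"
proof (induction rule: dec_induct)
  case (step m)
  then have "C ! m \<le> C ! i" "covers P (C ! Suc m) (C ! m)" using path_step by auto
  then show ?case using covers_less order.trans less_imp_le by metis
qed simp

lemma B_0: "0 < nblocks P C \<Longrightarrow> B 0 = 0"
  using B_less_iff[of 1 0] path_len by (simp add: loc_min_def)

lemma A_start_up:
  assumes "i < nblocks P C" "A_start P C i \<le> k" "k < T i" shows "up k"
  using up_ascending[OF assms(1) _ assms(3)] assms(1,2) B_0 by (cases i) (auto simp: A_start_def)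

text \<open>Every violation puts \<open>C ! j\<close> below an earlier element with an upward step
  in between: the step into \<open>T i\<close> if \<open>j\<close> lies in a descending block, the
  step out of \<open>B (Suc i)\<close> if it lies in an ascending one. Equality with the top itself
  contradicts distinctness.\<close>

lemma no_return_imp_cond_star:
  assumes "no_return P C" shows "cond_star P C"
  unfolding cond_star_def
proof (intro allI impI conjI)
  have nr: "\<not> C ! j \<le> C ! i" if "i \<le> k" "k < j" "j < length C" "up k" for i j k
    using assms that unfolding no_return_def by blast
  fix i assume i: "i + 1 < nblocks P C"
  then have i': "i < nblocks P C" "Suc i < nblocks P C" by auto
  have Tlast: "T i < length C - 1" using T_less_B[OF i'(2)] B_less_length[OF i'(2)] by simp
  show "V_D P C i \<inter> ((\<Union>m<i. gen_A P C m) \<union> gen_A_minus_top P C i \<union> {top_A P C i}) = {}"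
  proof (rule ccontr)
    assume "\<not> ?thesis"
    then obtain x where x: "x \<in> V_D P C i"
      "x \<in> (\<Union>m<i. gen_A P C m) \<union> gen_A_minus_top P C i \<union> {top_A P C i}" by blast
    from x(1) obtain j where "j \<in> {T i + 1..B (i + 1)}" and xj: "x = C ! j"
      unfolding V_D_def by blast
    then have j: "T i < j" "j \<le> B (Suc i)" by auto
    have jl: "j < length C" using j(2) B_less_length[OF i'(2)] by simp
    from x(2) consider m where "m < i" "x \<le> C ! T m" | a where "a \<in> V_A P C i - {top_A P C i}" "x \<le> a" | "x = C ! T i"
      by (auto simp: gen_A_def top_A_def gen_A_minus_top_def)
    then show False
    proof cases
      case 1
      have "T m < T i" using T_strict_mono 1(1) i' by simp
      then show False using nr[of "T m" "T i - 1" j] up_before_T[OF i'(1) _ Tlast] xj j jl 1(2) by auto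
    next
      case 2
      then obtain l where l: "l \<le> T i" "a = C ! l" "a \<noteq> C ! T i" by (auto simp: V_A_def top_A_def)
      then have "l < T i" by (metis le_neq_implies_less)
      then show False using nr[of l "T i - 1" j] up_before_T[OF i'(1) _ Tlast] xj j jl 2(2) l(2) by auto
    next
      case 3
      then show False using xj j jl path_distinct by (simp add: nth_eq_iff_index_eq)
    qed
  qed
  show "V_A P C (i + 1) \<inter> (\<Union>m\<le>i. gen_A P C m) = {}"
  proof (rule ccontr)
    assume "\<not> ?thesis"
    then obtain x m where x: "x \<in> V_A P C (i + 1)" "m \<le> i" "x \<le> C ! T m" by (auto simp: gen_A_def top_A_def)
    from x(1) obtain j where "j \<in> {A_start P C (i + 1)..T (i + 1)}" "x = C ! j"
      unfolding V_A_def by blast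
    then have j: "B (Suc i) < j" "j \<le> T (Suc i)" "x = C ! j" by (auto simp: A_start_def)
    have "T m \<le> T i" using T_strict_mono[of m i] x(2) i' by (cases "m = i") auto
    then show False
      using nr[of "T m" "B (Suc i)" j] T_less_B[OF i'(2)] up_B[OF i'(2)] j x(3) T_less_length[OF i'(2)] by auto
  qed
qed

text \<open>Each element lies below the top of its own ascending block or of the ascending block
  just before its descending one. A return to a lower element from a later block therefore meets an
  ideal that \<open>cond_star\<close> forbids; the remaining cases keep \<open>i\<close> and
  \<open>j\<close> close together.\<close>

lemma cond_star_imp_no_return:
  assumes "cond_star P C" shows "no_return P C"
  unfolding no_return_def
proof (intro allI impI notI)
  fix i j k
  assume ik: "i \<le> k" and kj: "k < j" and j: "j < length C" and le: "C ! j \<le> C ! i" and up: "up k"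
  have V_D: "V_D P C m \<inter> ((\<Union>l<m. gen_A P C l) \<union> gen_A_minus_top P C m \<union> {top_A P C m}) = {}"
    and V_A: "V_A P C (Suc m) \<inter> (\<Union>l\<le>m. gen_A P C l) = {}" if "Suc m < nblocks P C" for m
    using assms that by (auto simp: cond_star_def)
  have i: "i < length C" and CjP: "C ! j \<in> P" using ik kj j path_set by auto
  have in_gen: "C ! j \<in> gen_A P C m" if "C ! i \<le> C ! T m" for m
    using that le CjP by (auto simp: gen_A_def top_A_def)
  have asc_i: "C ! i \<le> C ! T m" if "m < nblocks P C" "A_start P C m \<le> i" "i \<le> T m" for m
    using that by (intro ascending_run T_less_length) (auto intro: A_start_up)
  have desc_i: "C ! i \<le> C ! T m" if "Suc m < nblocks P C" "T m < i" "i \<le> B (Suc m)" for m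
    using that i by (intro descending_run) (auto dest: not_up_descending)
  from j show False
  proof (cases rule: index_cases)
    case (asc b)
    have VA: "C ! j \<in> V_A P C b" using asc by (auto simp: V_A_def)
    have bad: False if "m < b" "C ! i \<le> C ! T m" for m
    proof -
      from that(1) obtain b' where b': "b = Suc b'" "m \<le> b'" by (cases b) auto
      with in_gen[OF that(2)] have "C ! j \<in> (\<Union>l\<le>b'. gen_A P C l)" by blast
      with V_A[of b'] VA asc(1) b'(1) show False by blast
    qed
    from i show False
    proof (cases rule: index_cases)
      case (asc a)
      show False
      proof (cases "a < b")
        case True
        then show False using bad asc_i asc by blast
      next
        case False
        \<comment> \<open>Here \<open>i\<close> and \<open>j\<close> lie in the same ascending
          block, along which the path strictly increases.\<close>
        have "A_start P C b \<le> i"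
        proof (cases "a = b")
          case False
          with \<open>\<not> a < b\<close> have "b < a" by simp
          then have "T b < i" using asc T_less_A_start[of b a] by simp
          then show ?thesis using \<open>j \<le> T b\<close> ik kj by simp
        qed (use asc in simp)
        then have "C ! Suc i \<le> C ! j" "up i"
          using \<open>b < nblocks P C\<close> \<open>j \<le> T b\<close> ik kj j
          by (auto intro!: ascending_run A_start_up[of b])
        then show False using le covers_less[of P "C ! i" "C ! Suc i"] by auto
      qed
    next
      case (desc a)
      have "a < b"
      proof (rule ccontr)
        assume "\<not> a < b"
        then have "T b \<le> T a" using T_strict_mono[of b a] desc by (cases "a = b") auto
        then show False using desc \<open>j \<le> T b\<close> ik kj by simp
      qed
      then show False using bad desc_i desc by blast
    qed
  next
    case (desc b)
    have VD: "C ! j \<in> V_D P C b" using desc by (auto simp: V_D_def)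
    have bad: False if "m < b" "C ! i \<le> C ! T m" for m
      using V_D[of b] VD in_gen[OF that(2)] that(1) desc(1) by auto
    \<comment> \<open>Otherwise the upward step \<open>k\<close> would lie in the descending run
      from \<open>T b\<close>.\<close>
    have iT: "i < T b"
    proof (rule ccontr)
      assume "\<not> i < T b"
      then show False using not_up_descending[OF desc(1), of k] desc(3) ik kj up by simp
    qed
    from i show False
    proof (cases rule: index_cases)
      case (asc a)
      have "\<not> b < a"
      proof
        assume "b < a"
        then have "T b < i" using asc T_less_A_start[of b a] by simp
        then show False using iT by simp
      qed
      moreover have "a \<noteq> b"
      proof
        assume "a = b"
        \<comment> \<open>As \<open>C ! i\<close> is not the top of its block, the part of
          \<open>cond_star\<close> on \<open>gen_A_minus_top\<close> applies.\<close>
        have "C ! i \<noteq> C ! T b" using path_distinct iT i T_less_length[of b] desc(1)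
          by (simp add: nth_eq_iff_index_eq)
        then have "C ! i \<in> V_A P C b - {top_A P C b}"
          using asc \<open>a = b\<close> by (auto simp: V_A_def top_A_def)
        then have "C ! j \<in> gen_A_minus_top P C b" using le CjP by (auto simp: gen_A_minus_top_def)
        then show False using V_D[OF desc(1)] VD by blast
      qed
      ultimately show False using bad[of a] asc_i asc by simp
    next
      case (desc a)
      have "a < b"
      proof (rule ccontr)
        assume "\<not> a < b"
        then have "T b \<le> T a" using T_strict_mono[of b a] desc by (cases "a = b") auto
        then show False using desc iT by simp
      qed
      then show False using bad desc_i desc by blast
    qed
  qed
qed

end

section \<open>Degrees outside the Frobenius power\<close>

lemma covers_rtranclp:
  assumes "finite P" "x \<in> P" "y \<in> P" "x \<le> y"
  shows "(covers P)\<^sup>*\<^sup>* x y"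
proof -
  obtain ds where ds: "ds \<noteq> []" "hd ds = y" "last ds = x" "successively (\<lambda>x y. covers P y x) ds"
    using descending_chain[OF assms(1,3,2,4)] .
  have "(covers P)\<^sup>*\<^sup>* (last ds) (hd ds)" if "ds \<noteq> []" "successively (\<lambda>x y. covers P y x) ds" for ds
    using that
  proof (induction ds rule: induct_list012)
    case (3 a b zs)
    then show ?case by (auto intro: rtranclp.rtrancl_into_rtrancl)
  qed auto
  with ds show ?thesis by metis
qed

lemma covers_rtranclp_imp_le: "(covers P)\<^sup>*\<^sup>* x y \<Longrightarrow> x \<le> y"
  by (induction rule: rtranclp_induct) (auto dest: covers_less)

text \<open>A chain of covers from inside \<open>I\<close> to outside crosses its boundary at some
  cover, which gives the place where a drop can be measured.\<close>

lemma covers_rtranclp_leave: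
  assumes "(covers P)\<^sup>*\<^sup>* x y" "x \<in> I" "y \<notin> I"
  obtains a b where "covers P a b" "a \<in> I" "b \<notin> I" "x \<le> a" "b \<le> y"
proof -
  have "y \<in> I \<or> (\<exists>a b. covers P a b \<and> a \<in> I \<and> b \<notin> I \<and> x \<le> a \<and> b \<le> y)"
    using assms(1)
  proof (induction rule: rtranclp_induct)
    case (step y z)
    have "y < z" "x \<le> y" using step.hyps by (auto dest: covers_less covers_rtranclp_imp_le)
    then show ?case using step by (meson order.trans less_imp_le order.refl)
  qed (use assms(2) in simp)
  with assms(3) that show ?thesis by blast
qed

text \<open>Downward steps never lower \<open>v\<close>, so only upward steps contribute, at most
  \<open>q - 1\<close> each. For \<open>q = 0\<close> upward steps are impossible by
  \<open>anti\<close>, so the truncated subtraction is harmless.\<close>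

lemma walk_drop_bound:
  fixes v :: "'a::order \<Rightarrow> nat"
  assumes "C \<noteq> []" "successively (\<lambda>x y. covers P y x \<or> covers P x y \<and> v x < v y + q) C"
    and anti: "\<And>x y. covers P x y \<Longrightarrow> v y \<le> v x"
  shows "v (hd C) \<le> v (last C) + upper_len P C * (q - 1)"
  using assms(1,2)
proof (induction C rule: induct_list012)
  case (3 x y zs)
  then have IH: "v y \<le> v (last (y # zs)) + upper_len P (y # zs) * (q - 1)" by simp
  show ?case
  proof (cases "covers P x y")
    case True
    then have "v x < v y + q" using 3 covers_asym by auto
    then show ?thesis using IH True by (simp add: upper_len_Cons)
  next
    case False
    then have "v x \<le> v y" using 3 anti by auto
    then show ?thesis using IH False by (simp add: upper_len_Cons)
  qed
qed auto

text \<open>The requirement that the last step go up is automatic, since nothing covers a maximal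
  element.\<close>

lemma maximal_pathI:
  assumes "C \<noteq> []" "distinct C" "set C \<subseteq> P" "minimal_in P (hd C)" "maximal_in P (last C)"
    and "successively (\<lambda>x y. covers P x y \<or> covers P y x) C"
  shows "is_maximal_path P C"
proof -
  have step: "covers P (C ! i) (C ! Suc i) \<or> covers P (C ! Suc i) (C ! i)" if "Suc i < length C" for i
    using assms(6) that
  proof (induction C arbitrary: i rule: induct_list012)
    case (3 x y zs)
    then show ?case by (cases i) auto
  qed auto
  moreover have "covers P (C ! (length C - 2)) (C ! (length C - 1))" if "2 \<le> length C"
  proof -
    have "Suc (length C - 2) = length C - 1" using that by simp
    moreover have "\<not> covers P (last C) (C ! (length C - 2))"
      using assms(5) by (auto simp: maximal_in_def covers_def)
    ultimately show ?thesis using step[of "length C - 2"] that assms(1) by (simp add: last_conv_nth)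
  qed
  ultimately show ?thesis
    using assms by (simp add: is_maximal_path_def is_path_def hd_conv_nth)
qed

text \<open>If the walk-reachable set contains no maximal element of small height, it is a poset ideal
  witnessing membership in \<open>frobenius_exps\<close>.\<close>

lemma not_frobenius_imp_path:
  fixes P :: "'a::order set"
  assumes "finite P" "P \<noteq> {}" "u \<in> hibi_monoid P" "u \<notin> frobenius_exps P q"
  obtains C where "is_maximal_path P C" "cond_star P C"
    "Poly_Mapping.lookup u None \<le> (upper_len P C + 2) * (q - 1)"
proof -
  define v where "v x = Poly_Mapping.lookup u (Some x)" for x
  define N where "N = Poly_Mapping.lookup u None"
  define step where "step x y \<longleftrightarrow> covers P y x \<or> covers P x y \<and> v x < v y + q" for x y
  \<comment> \<open>The condition on \<open>hd C\<close> is the drop bound for the step from the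
    added bottom, whose value is \<open>N\<close>.\<close>
  define walk where "walk C \<longleftrightarrow> C \<noteq> [] \<and> set C \<subseteq> P \<and> minimal_in P (hd C) \<and> N < v (hd C) + q \<and>
    successively step C" for C
  define I where "I = {last C | C. walk C}"
  have anti: "v y \<le> v x" if "x \<in> P" "y \<in> P" "x \<le> y" for x y
    using assms(3) that by (simp add: hibi_monoid_def v_def)
  have anti': "v y \<le> v x" if "covers P x y" for x y
    using that anti by (auto simp: covers_def)
  have vN: "v x \<le> N" if "x \<in> P" for x
    using assms(3) that by (simp add: hibi_monoid_def v_def N_def)
  have v0: "v x = 0" if "x \<notin> P" for x
    using assms(3) that by (simp add: hibi_monoid_def v_def)
  have IP: "I \<subseteq> P" by (auto simp: I_def walk_def)
  have I_step: "y \<in> I" if "x \<in> I" "step x y" for x y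
  proof -
    obtain C where C: "walk C" "x = last C" using \<open>x \<in> I\<close> by (auto simp: I_def)
    have "y \<in> P" using that(2) by (auto simp: step_def covers_def)
    then have "walk (C @ [y])" using C that(2) by (auto simp: walk_def successively_append_iff)
    then show ?thesis unfolding I_def by (metis (mono_tags, lifting) last_snoc mem_Collect_eq)
  qed
  have I_min: "m \<in> I" if "minimal_in P m" "N < v m + q" for m
  proof -
    have "walk [m]" using that by (simp add: walk_def minimal_in_def)
    then show ?thesis unfolding I_def by (metis (mono_tags, lifting) last.simps mem_Collect_eq)
  qed
  \<comment> \<open>A chain from \<open>x\<close> to \<open>y\<close> leaves \<open>I\<close> at a
    cover that is no permitted step, so \<open>v\<close> already drops by \<open>q\<close>
    there.\<close>
  have leave: "v y + q \<le> v x" if "x \<in> I" "y \<in> P" "x \<le> y" "y \<notin> I" for x y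
  proof -
    have "(covers P)\<^sup>*\<^sup>* x y" using covers_rtranclp[OF assms(1)] that IP by blast
    then obtain a b where ab: "covers P a b" "a \<in> I" "b \<notin> I" "x \<le> a" "b \<le> y"
      using covers_rtranclp_leave \<open>x \<in> I\<close> \<open>y \<notin> I\<close> by metis
    have "\<not> step a b" using I_step ab by blast
    then have "v b + q \<le> v a" using ab(1) by (simp add: step_def)
    moreover have "v a \<le> v x" "v y \<le> v b" using anti ab that IP by (auto simp: covers_def)
    ultimately show ?thesis by simp
  qed
  have I_ideal: "I \<in> poset_ideals P"
  proof -
    have "y \<in> I" if "x \<in> I" "y \<in> P" "y \<le> x" for x y
    proof -
      have "(covers P)\<^sup>*\<^sup>* y x" using covers_rtranclp[OF assms(1)] that IP by blast
      then show ?thesis using \<open>x \<in> I\<close>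
        by (induction rule: converse_rtranclp_induct) (auto intro: I_step simp: step_def)
    qed
    then show ?thesis using IP by (auto simp: poset_ideals_def)
  qed
  have "\<exists>m\<in>I. maximal_in P m \<and> v m < q"
  proof (rule ccontr)
    assume no: "\<not> ?thesis"
    have ge_q: "q \<le> v x" if xI: "x \<in> I" for x
    proof -
      obtain m where m: "maximal_in P m" "x \<le> m" using ex_maximal_above[OF assms(1)] xI IP by blast
      then have "m \<in> P" by (simp add: maximal_in_def)
      show ?thesis
      proof (cases "m \<in> I")
        case True
        then show ?thesis using no m anti[of x m] that IP \<open>m \<in> P\<close> by force
      next
        case False
        then show ?thesis using leave[OF that \<open>m \<in> P\<close> m(2)] by simp
      qed
    qed
    \<comment> \<open>The counterpart of \<open>leave\<close> for the added bottom: a minimal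
      element below \<open>x\<close> is either in \<open>I\<close>, so \<open>leave\<close> applies,
      or is kept out by a drop of at least \<open>q\<close> from \<open>N\<close>.\<close>
    have le_N: "v x + q \<le> N" if "x \<in> P" "x \<notin> I" for x
    proof -
      obtain m where m: "minimal_in P m" "m \<le> x" using ex_minimal_below[OF assms(1)] \<open>x \<in> P\<close> by blast
      then have "m \<in> P" by (simp add: minimal_in_def)
      show ?thesis
      proof (cases "m \<in> I")
        case True
        then show ?thesis using leave[OF True that(1) m(2) that(2)] vN[OF \<open>m \<in> P\<close>] by simp
      next
        case False
        then show ?thesis using I_min[OF m(1)] anti[OF \<open>m \<in> P\<close> that(1) m(2)] by force
      qed
    qed
    have qN: "q \<le> N"
    proof -
      obtain x where "x \<in> P" using assms(2) by blast
      then show ?thesis using ge_q[of x] le_N[of x] vN[of x] by (cases "x \<in> I") auto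
    qed
    have finI: "finite I" using IP assms(1) finite_subset by blast
    \<comment> \<open>The quotient by the \<open>q\<close>-th power of the generator of
      \<open>I\<close>. The truncated subtraction is exact by \<open>qN\<close> and
      \<open>ge_q\<close>, and \<open>leave\<close> and \<open>le_N\<close> keep the quotient in the
      monoid.\<close>
    define w where "w = u - (\<Sum>i<q. hibi_exp I)"
    have wN: "Poly_Mapping.lookup w None = N - q"
      by (simp add: w_def lookup_minus lookup_sum_const N_def)
    have ws: "Poly_Mapping.lookup w (Some x) = (if x \<in> I then v x - q else v x)" for x
      by (simp add: w_def lookup_minus lookup_sum_const v_def lookup_hibi_exp_Some finI)
    have "Poly_Mapping.lookup u k = Poly_Mapping.lookup (w + (\<Sum>i<q. hibi_exp I)) k" for k
    proof (cases k)
      case None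
      then show ?thesis using qN by (simp add: lookup_add wN lookup_sum_const N_def)
    next
      case (Some x)
      then show ?thesis using ge_q[of x]
        by (simp add: lookup_add ws lookup_sum_const lookup_hibi_exp_Some finI v_def)
    qed
    then have "u = w + (\<Sum>i<q. hibi_exp I)" by (rule poly_mapping_eqI)
    moreover have "w \<in> hibi_monoid P"
      unfolding hibi_monoid_def mem_Collect_eq wN ws
    proof (intro conjI allI impI ballI)
      fix x assume "x \<notin> P"
      then show "(if x \<in> I then v x - q else v x) = 0" using v0 by simp
    next
      fix x assume "x \<in> P"
      then show "(if x \<in> I then v x - q else v x) \<le> N - q" using vN[of x] le_N[of x] by auto
    next
      fix x y assume xy: "x \<in> P" "y \<in> P" "x \<le> y"
      have "y \<in> I \<Longrightarrow> x \<in> I" using poset_ideals_down[OF I_ideal] xy by blast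
      then show "(if y \<in> I then v y - q else v y) \<le> (if x \<in> I then v x - q else v x)"
        using anti[OF xy] leave[OF _ xy(2,3)] by auto
    qed
    ultimately have "u \<in> frobenius_exps P q" using I_ideal unfolding frobenius_exps_def by blast
    then show False using assms(4) by blast
  qed
  then obtain C where C: "walk C" "maximal_in P (last C)" "v (last C) < q" by (auto simp: I_def)
  have "step x y \<Longrightarrow> covers P x y \<or> covers P y x" "covers P y x \<Longrightarrow> step x y" for x y
    by (auto simp: step_def)
  then obtain D where D: "D \<noteq> []" "set D \<subseteq> P" "successively step D" "hd D = hd C" "last D = last C"
    "distinct D" "no_return P D"
    using ex_no_return_walk[OF assms(1), of step C] C(1) unfolding walk_def by metis
  have zig: "successively (\<lambda>x y. covers P x y \<or> covers P y x) D"
    using D(3) by (rule successively_mono) (auto simp: step_def)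
  have path: "is_maximal_path P D"
    using D C zig by (intro maximal_pathI) (auto simp: walk_def)
  moreover have "cond_star P D"
    using path D(7) by (intro no_return_imp_cond_star) (simp_all add: is_maximal_path_def)
  moreover have "v (hd D) \<le> v (last D) + upper_len P D * (q - 1)"
    using D(1,3) anti' unfolding step_def by (rule walk_drop_bound)
  then have "N \<le> (upper_len P D + 2) * (q - 1)"
  proof -
    \<comment> \<open>The drops from the added bottom to the start and from the end to the added top
      give the summand 2.\<close>
    have "N \<le> v (hd D) + (q - 1)" "v (last D) \<le> q - 1" using C D(4,5) by (auto simp: walk_def)
    moreover have "(upper_len P D + 2) * (q - 1) = upper_len P D * (q - 1) + (q - 1) + (q - 1)"
      by (simp only: add_mult_distrib mult_2 add.assoc)
    ultimately show ?thesis using \<open>v (hd D) \<le> _\<close> by linarith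
  qed
  ultimately show ?thesis using that unfolding N_def by blast
qed

text \<open>Conversely, a path satisfying \<open>(*)\<close> carries an order-reversing function that drops by
  exactly \<open>q - 1\<close> along upward steps and is constant along downward ones.\<close>

lemma path_imp_not_frobenius:
  fixes P :: "'a::order set"
  assumes "finite P" "is_maximal_path P C" "cond_star P C" "0 < q"
  obtains u where "u \<in> hibi_monoid P" "u \<notin> frobenius_exps P q"
    "Poly_Mapping.lookup u None = (upper_len P C + 2) * (q - 1)"
proof -
  have path: "is_path P C" and max: "maximal_in P (last C)"
    using assms(2) by (auto simp: is_maximal_path_def)
  have nr: "no_return P C" using path assms(3) by (rule cond_star_imp_no_return)
  have len: "0 < length C" and CP: "set C \<subseteq> P" and
    step: "\<And>i. Suc i < length C \<Longrightarrow> covers P (C ! i) (C ! Suc i) \<or> covers P (C ! Suc i) (C ! i)"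
    using path by (auto simp: is_path_def)
  define S where "S j = {k. j \<le> k \<and> Suc k < length C \<and> covers P (C ! k) (C ! Suc k)}" for j
  \<comment> \<open>The height at index \<open>j\<close> pays \<open>q - 1\<close> for each upward
    step still to come and once more for the drop from the end of the path to the added top.\<close>
  define w where "w j = (1 + card (S j)) * (q - 1)" for j
  \<comment> \<open>The least order-reversing extension of these heights; elements below no path
    element get the default 0.\<close>
  define v where "v x = Max (insert 0 (w ` {j. j < length C \<and> x \<le> C ! j}))" for x
  define N where "N = (upper_len P C + 2) * (q - 1)"
  have finS: "finite (S j)" for j by (rule finite_subset[of _ "{..<length C}"]) (auto simp: S_def)
  have S0: "card (S 0) = upper_len P C" by (simp add: S_def upper_len_def)
  have w_anti: "w j \<le> w i" if "i \<le> j" for i j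
  proof -
    have "S j \<subseteq> S i" using that by (auto simp: S_def)
    then show ?thesis using finS by (simp add: w_def card_mono)
  qed
  have w_up: "w i = w (Suc i) + (q - 1)" if "Suc i < length C" "covers P (C ! i) (C ! Suc i)" for i
  proof -
    have "S i = insert i (S (Suc i))" using that by (auto simp: S_def Suc_le_eq le_less)
    moreover have "i \<notin> S (Suc i)" by (simp add: S_def)
    ultimately show ?thesis using finS by (simp add: w_def)
  qed
  \<comment> \<open>This is where \<open>no_return\<close> enters: a later element below an earlier
    one has lost no height, so the maximum defining \<open>v\<close> reproduces \<open>w\<close> on
    the path.\<close>
  have w_back: "w i \<le> w j" if "i < length C" "j < length C" "C ! j \<le> C ! i" for i j
  proof (cases "i < j")
    case True
    have "S i \<subseteq> S j"
    proof
      fix k assume k: "k \<in> S i"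
      have "\<not> k < j" using nr k that unfolding no_return_def S_def by blast
      then show "k \<in> S j" using k by (simp add: S_def)
    qed
    then show ?thesis using finS by (simp add: w_def card_mono)
  next
    case False
    then show ?thesis by (intro w_anti) simp
  qed
  have vC: "v (C ! j) = w j" if "j < length C" for j
    unfolding v_def using that by (intro Max_eqI) (auto intro: w_back)
  have v_anti: "v y \<le> v x" if "x \<le> y" for x y
    unfolding v_def using that by (intro Max_mono) auto
  have vN: "v x \<le> N" for x
  proof -
    have "w 0 \<le> N" unfolding w_def N_def S0 by (intro mult_right_mono) auto
    then have "w j \<le> N" for j using w_anti[of 0 j] by simp
    then show ?thesis unfolding v_def by (intro Max.boundedI) auto
  qed
  define u where "u = Poly_Mapping.single None N + (\<Sum>x\<in>P. Poly_Mapping.single (Some x) (v x))"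
  have uN: "Poly_Mapping.lookup u None = N"
    by (simp add: u_def lookup_add lookup_sum lookup_single)
  have us: "Poly_Mapping.lookup u (Some x) = (if x \<in> P then v x else 0)" for x
    using assms(1) by (simp add: u_def lookup_add lookup_sum lookup_single when_def)
  have "u \<in> hibi_monoid P"
    using v_anti vN by (auto simp: hibi_monoid_def uN us)
  moreover have "u \<notin> frobenius_exps P q"
  proof
    assume "u \<in> frobenius_exps P q"
    then obtain t I where tI: "u = t + (\<Sum>i<q. hibi_exp I)" "t \<in> hibi_monoid P" "I \<in> poset_ideals P"
      by (auto simp: frobenius_exps_def)
    have IP: "I \<subseteq> P" using tI(3) by (rule poset_ideals_subset)
    then have finI: "finite I" using assms(1) finite_subset by blast
    have tN: "N = Poly_Mapping.lookup t None + q"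
      unfolding uN[symmetric] tI(1) by (simp add: lookup_add lookup_sum_const)
    have tv: "v x = Poly_Mapping.lookup t (Some x) + (if x \<in> I then q else 0)" if "x \<in> P" for x
      using us[of x] that unfolding tI(1)
      by (simp add: lookup_add lookup_sum_const lookup_hibi_exp_Some finI split: if_splits)
    \<comment> \<open>The ideal \<open>I\<close> is pushed along the path: leaving it on an upward
      step, or missing the start, would need a drop of at least \<open>q\<close>, but only
      \<open>q - 1\<close> is available. The last element, of height \<open>q - 1\<close>, then
      cannot lie in \<open>I\<close>.\<close>
    have "C ! j \<in> I" if "j < length C" for j
      using that
    proof (induction j)
      case 0
      have "C ! 0 \<in> P" using CP 0 by auto
      then have "Poly_Mapping.lookup t (Some (C ! 0)) \<le> Poly_Mapping.lookup t None"
        using tI(2) by (simp add: hibi_monoid_def)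
      moreover have "N = v (C ! 0) + (q - 1)" using vC[OF 0] by (simp add: N_def w_def S0)
      ultimately show ?case using tv[OF \<open>C ! 0 \<in> P\<close>] tN assms(4) by (auto split: if_splits)
    next
      case (Suc j)
      then have j: "C ! j \<in> I" "j < length C" by auto
      have P: "C ! j \<in> P" "C ! Suc j \<in> P" using CP Suc.prems by auto
      show ?case
      proof (cases "covers P (C ! j) (C ! Suc j)")
        case True
        have "Poly_Mapping.lookup t (Some (C ! Suc j)) \<le> Poly_Mapping.lookup t (Some (C ! j))"
          using tI(2) P covers_less[OF True] by (simp add: hibi_monoid_def)
        moreover have "v (C ! j) = v (C ! Suc j) + (q - 1)"
          using vC w_up[OF Suc.prems True] Suc.prems by simp
        ultimately show ?thesis using tv[OF P(1)] tv[OF P(2)] j(1) assms(4) by (auto split: if_splits)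
      next
        case False
        then have "C ! Suc j \<le> C ! j" using step[OF Suc.prems] covers_less less_imp_le by blast
        then show ?thesis using poset_ideals_down[OF tI(3) j(1) P(2)] by blast
      qed
    qed
    then have "C ! (length C - 1) \<in> I" using len by simp
    moreover from this IP have "C ! (length C - 1) \<in> P" by blast
    moreover have "S (length C - 1) = {}" by (auto simp: S_def)
    then have "v (C ! (length C - 1)) = q - 1" using vC[of "length C - 1"] len by (simp add: w_def)
    ultimately show False using tv assms(4) by simp
  qed
  ultimately show ?thesis using that uN N_def by blast
qed

section \<open>The exact value of \<open>nu\<close> and the limit\<close>

lemma nu_hibi:
  fixes P :: "'a::order set"
  assumes "finite P" "P \<noteq> {}" "prime p" "CHAR('k::comm_ring_1) = p"
  shows "nu (hibi_ring P :: ('a, 'k) mpoly set) (hibi_max_ideal P) (p ^ e) = (upper_rank P + 2) * (p ^ e - 1)"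
proof -
  let ?U = "{upper_len P C | C. is_maximal_path P C \<and> cond_star P C}"
  \<comment> \<open>Paths have distinct elements, so the maximum in \<open>upper_rank\<close> ranges
    over a finite set.\<close>
  have "upper_len P C \<le> card P" if "is_maximal_path P C" for C
  proof -
    have "upper_len P C \<le> card {..<length C}"
      unfolding upper_len_def by (intro card_mono) auto
    also have "\<dots> = card (set C)"
      using that by (simp add: is_maximal_path_def is_path_def distinct_card)
    also have "\<dots> \<le> card P"
      using that assms(1) by (intro card_mono) (auto simp: is_maximal_path_def is_path_def)
    finally show ?thesis .
  qed
  then have finU: "finite ?U" by (intro finite_subset[of ?U "{..card P}"]) auto
  \<comment> \<open>Applied to the zero exponent and \<open>q = 1\<close>,
    \<open>not_frobenius_imp_path\<close> shows that some maximal path satisfies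
    \<open>cond_star\<close>, so the maximum is attained.\<close>
  have "0 \<notin> frobenius_exps P 1"
  proof
    assume "0 \<in> frobenius_exps P 1"
    then obtain t :: "'a option \<Rightarrow>\<^sub>0 nat" and I where "0 = t + hibi_exp I" by (auto simp: frobenius_exps_def)
    then have "Poly_Mapping.lookup (t + hibi_exp I) None = 0" by simp
    then show False by (simp add: lookup_add)
  qed
  then have "?U \<noteq> {}"
    using not_frobenius_imp_path[OF assms(1,2) hibi_monoid_0] by blast
  then have "upper_rank P \<in> ?U"
    unfolding upper_rank_def by (rule Max_in[OF finU])
  then obtain C where C: "is_maximal_path P C" "cond_star P C" "upper_len P C = upper_rank P" by auto
  have "0 < p ^ e" using assms(3) prime_gt_0_nat by simp
  then obtain v where v: "v \<in> hibi_monoid P" "v \<notin> frobenius_exps P (p ^ e)"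
    "Poly_Mapping.lookup v None = (upper_rank P + 2) * (p ^ e - 1)"
    using path_imp_not_frobenius[OF assms(1) C(1,2)] C(3) by metis
  have "Poly_Mapping.lookup u None \<le> Poly_Mapping.lookup v None"
    if u: "u \<in> hibi_monoid P" "u \<notin> frobenius_exps P (p ^ e)" for u
  proof -
    obtain D where D: "is_maximal_path P D" "cond_star P D"
      "Poly_Mapping.lookup u None \<le> (upper_len P D + 2) * (p ^ e - 1)"
      using not_frobenius_imp_path[OF assms(1,2) u] .
    have "upper_len P D \<le> upper_rank P"
      unfolding upper_rank_def using D(1,2) by (intro Max_ge[OF finU]) blast
    then have "(upper_len P D + 2) * (p ^ e - 1) \<le> (upper_rank P + 2) * (p ^ e - 1)"
      by (intro mult_right_mono) auto
    then show ?thesis using D(3) v(3) by linarith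
  qed
  then show ?thesis
    using nu_hibi_eqI[OF assms(1,3,4) v(1,2)] v(3) by simp
qed

theorem theorem2p4:
  fixes P :: "'a::order set" and p :: nat
  assumes "finite P" and "P \<noteq> {}"
    and "prime p" and "CHAR('k::field) = p"
  shows "(\<lambda>e. real (nu (hibi_ring P :: ('a, 'k) mpoly set) (hibi_max_ideal P) (p ^ e)) / real (p ^ e))
           \<longlonglongrightarrow> real (upper_rank P + 2)"
proof -
  let ?r = "real (upper_rank P + 2)"
  have p: "1 < p" using assms(3) by (rule prime_gt_1_nat)
  \<comment> \<open>The exact value of \<open>nu\<close> turns the quotient into a constant times a
    term tending to 1.\<close>
  have "real (nu (hibi_ring P :: ('a, 'k) mpoly set) (hibi_max_ideal P) (p ^ e)) / real (p ^ e)
      = ?r * (1 - (1 / real p) ^ e)" for e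
  proof -
    have "real (p ^ e - 1) = real p ^ e - 1" using p by (simp add: of_nat_diff)
    then have "real ((upper_rank P + 2) * (p ^ e - 1)) = ?r * (real p ^ e - 1)"
      by (simp only: of_nat_mult)
    then show ?thesis
      using p unfolding nu_hibi[OF assms] by (simp add: field_simps)
  qed
  moreover have "(\<lambda>e. (1 / real p) ^ e) \<longlonglongrightarrow> 0"
    using p by (intro LIMSEQ_realpow_zero) auto
  then have "(\<lambda>e. ?r * (1 - (1 / real p) ^ e)) \<longlonglongrightarrow> ?r * (1 - 0)"
    by (intro tendsto_mult tendsto_diff tendsto_const)
  ultimately show ?thesis by simp
qed

end
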